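(* Let $\{W(t),t\in\mathbb{R}^d\}$ be a zero-mean Gaussian process with stationary increments and variance $\sigma^2(t)=\operatorname{Var}W(t)$. Then the process $\xi(t)=W(t)-\sigma^2(t)/2$, $t\in\mathbb{R}^d$, is Brown–Resnick stationary.
   Context: A process $\{W(t),t\in\mathbb{R}^d\}$ has stationary increments if the law of $\{W(t+t_0)-W(t_0),t\in\mathbb{R}^d\}$ does not depend on $t_0\in\mathbb{R}^d$. Gaussian processes with stationary increments are always assumed to have zero mean. Brown–Resnick stationarity: a process $\{\xi(t),t\in\mathbb{R}^d\}$ satisfying $\mathbb{E}e^{\xi(t)}<\infty$ for all $t\in\mathbb{R}^d$ is called Brown–Resnick stationary if the process $\eta(t)=\bigvee_{i=1}^\infty(U_i+\xi_i(t))$, $t\in\mathbb{R}^d$, is stationary (its finite-dimensional distributions are invariant under translations of $\mathbb{R}^d$), where $\xi_i$, $i\in\mathbb{N}$, are independent copies of $\xi$ and, independently of them, $\sum_{i=1}^\infty\delta_{U_i}$ is a Poisson point process on $\mathbb{R}$ with intensity $e^{-y}\,dy$. $\bigvee$ denotes the supremum. *)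

theory Defs
  imports "HOL-Probability.Probability"
begin

text \<open>
  Stochastic processes are families \<open>X :: 't \<Rightarrow> 'a \<Rightarrow> 'v\<close> of random variables on a probability
  space \<open>M\<close>.  Their law is taken on the product sigma-algebra of all coordinates.
\<close>

definition stochastic_process ::
  "'a measure \<Rightarrow> ('t \<Rightarrow> 'a \<Rightarrow> 'v::topological_space) \<Rightarrow> bool" where
  "stochastic_process M X \<longleftrightarrow> prob_space M \<and> (\<forall>t. X t \<in> borel_measurable M)"

definition process_law ::
  "'a measure \<Rightarrow> ('t \<Rightarrow> 'a \<Rightarrow> 'v::topological_space) \<Rightarrow> ('t \<Rightarrow> 'v) measure" where
  "process_law M X = distr M (Pi\<^sub>M UNIV (\<lambda>_. borel)) (\<lambda>\<omega> t. X t \<omega>)"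

definition finite_dim_distr ::
  "'a measure \<Rightarrow> ('t \<Rightarrow> 'a \<Rightarrow> 'v::topological_space) \<Rightarrow> 't set \<Rightarrow> ('t \<Rightarrow> 'v) measure" where
  "finite_dim_distr M X J = distr M (Pi\<^sub>M J (\<lambda>_. borel)) (\<lambda>\<omega>. \<lambda>t\<in>J. X t \<omega>)"

definition stationary_process ::
  "'a measure \<Rightarrow> (real ^ 'd \<Rightarrow> 'a \<Rightarrow> 'v::topological_space) \<Rightarrow> bool" where
  "stationary_process M X \<longleftrightarrow> stochastic_process M X \<and>
     (\<forall>h J. finite J \<longrightarrow> finite_dim_distr M (\<lambda>t. X (t + h)) J = finite_dim_distr M X J)"

definition stationary_increments ::
  "'a measure \<Rightarrow> (real ^ 'd \<Rightarrow> 'a \<Rightarrow> real) \<Rightarrow> bool" where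
  "stationary_increments M W \<longleftrightarrow>
     (\<forall>s u. process_law M (\<lambda>t \<omega>. W (t + s) \<omega> - W s \<omega>)
          = process_law M (\<lambda>t \<omega>. W (t + u) \<omega> - W u \<omega>))"

text \<open>
  The library's \<^const>\<open>normal_density\<close> describes a normal law only for positive standard
  deviation; Gaussian processes may have degenerate marginals, so point masses are included.
\<close>

definition normal_law :: "real \<Rightarrow> real \<Rightarrow> real measure" where
  "normal_law \<mu> \<sigma> =
     (if \<sigma> = 0 then return borel \<mu> else density lborel (\<lambda>x. ennreal (normal_density \<mu> \<sigma> x)))"

definition gaussian_process :: "'a measure \<Rightarrow> ('t \<Rightarrow> 'a \<Rightarrow> real) \<Rightarrow> bool" where
  "gaussian_process M W \<longleftrightarrow> stochastic_process M W \<and>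
     (\<forall>J c. finite J \<longrightarrow>
        (\<exists>\<mu> \<sigma>. 0 \<le> \<sigma> \<and> distr M borel (\<lambda>\<omega>. \<Sum>t\<in>J. c t * W t \<omega>) = normal_law \<mu> \<sigma>))"

definition zero_mean :: "'a measure \<Rightarrow> ('t \<Rightarrow> 'a \<Rightarrow> real) \<Rightarrow> bool" where
  "zero_mean M W \<longleftrightarrow> (\<forall>t. integral\<^sup>L M (W t) = 0)"

text \<open>
  \<open>point_count U A\<close> is the mass that the sum of the Dirac measures at the points \<open>U i\<close> gives
  to \<open>A\<close>; it may be infinite.
\<close>

definition point_count :: "(nat \<Rightarrow> 'a \<Rightarrow> real) \<Rightarrow> real set \<Rightarrow> 'a \<Rightarrow> ennreal" where
  "point_count U A \<omega> = (\<Sum>i. emeasure (return borel (U i \<omega>)) A)"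

text \<open>
  On sets of infinite intensity no law is prescribed: for a sigma-finite intensity the count is
  then almost surely infinite as a consequence of the two conditions.
\<close>

definition poisson_point_process ::
  "'a measure \<Rightarrow> real measure \<Rightarrow> (nat \<Rightarrow> 'a \<Rightarrow> real) \<Rightarrow> bool" where
  "poisson_point_process N \<Lambda> U \<longleftrightarrow> stochastic_process N U \<and>
     (\<forall>A\<in>sets borel. emeasure \<Lambda> A < \<infinity> \<longrightarrow>
        (\<forall>k. measure N {\<omega> \<in> space N. point_count U A \<omega> = of_nat k}
              = measure \<Lambda> A ^ k / fact k * exp (- measure \<Lambda> A))) \<and>
     (\<forall>n A. (\<forall>j<n. A j \<in> sets borel) \<longrightarrow> disjoint_family_on A {..<n} \<longrightarrow>
        prob_space.indep_vars N (\<lambda>_. borel) (\<lambda>j. point_count U (A j)) {..<n::nat})"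

definition exp_intensity :: "real measure" where
  "exp_intensity = density lborel (\<lambda>y. ennreal (exp (- y)))"

definition independent_copies ::
  "'a measure \<Rightarrow> ('t \<Rightarrow> 'a \<Rightarrow> real) \<Rightarrow> 'b measure \<Rightarrow> (nat \<Rightarrow> 't \<Rightarrow> 'b \<Rightarrow> real) \<Rightarrow> bool" where
  "independent_copies M \<xi> N X \<longleftrightarrow>
     (\<forall>i. stochastic_process N (X i) \<and> process_law N (X i) = process_law M \<xi>) \<and>
     prob_space.indep_vars N (\<lambda>_. Pi\<^sub>M UNIV (\<lambda>_. borel)) (\<lambda>i \<omega> t. X i t \<omega>) UNIV"

text \<open>
  Independence is required of the sequence of points \<open>U\<close> itself, not merely of the random set of
  its values: otherwise the labelling could depend on the copies \<open>X i\<close> and the law of the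
  supremum would not be determined.
\<close>

definition brown_resnick_realisation ::
  "'a measure \<Rightarrow> ('t \<Rightarrow> 'a \<Rightarrow> real) \<Rightarrow>
   'b measure \<Rightarrow> (nat \<Rightarrow> 't \<Rightarrow> 'b \<Rightarrow> real) \<Rightarrow> (nat \<Rightarrow> 'b \<Rightarrow> real) \<Rightarrow> bool" where
  "brown_resnick_realisation M \<xi> N X U \<longleftrightarrow>
     prob_space N \<and>
     independent_copies M \<xi> N X \<and>
     poisson_point_process N exp_intensity U \<and>
     prob_space.indep_set N
       (sets (vimage_algebra (space N) (\<lambda>\<omega> i t. X i t \<omega>)
          (Pi\<^sub>M UNIV (\<lambda>_. Pi\<^sub>M UNIV (\<lambda>_. borel)))))
       (sets (vimage_algebra (space N) (\<lambda>\<omega> i. U i \<omega>) (Pi\<^sub>M UNIV (\<lambda>_. borel))))"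

text \<open>The supremum is finite almost surely; on the exceptional null set it may be infinite.\<close>

definition brown_resnick_sup ::
  "(nat \<Rightarrow> 't \<Rightarrow> 'b \<Rightarrow> real) \<Rightarrow> (nat \<Rightarrow> 'b \<Rightarrow> real) \<Rightarrow> 't \<Rightarrow> 'b \<Rightarrow> ereal" where
  "brown_resnick_sup X U t \<omega> = (SUP i. ereal (U i \<omega> + X i t \<omega>))"

text \<open>
  The property concerns the law of the supremum process only, so it must hold on every
  probability space carrying the copies and the Poisson points.  HOL does not quantify over the
  type of the sample space inside a definition, hence the type argument; for the full notion it
  has to be left arbitrary, as a free type variable of the theorem.
\<close>

definition brown_resnick_stationary ::
  "'b itself \<Rightarrow> 'a measure \<Rightarrow> (real ^ 'd \<Rightarrow> 'a \<Rightarrow> real) \<Rightarrow> bool" where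
  "brown_resnick_stationary _ M \<xi> \<longleftrightarrow>
     stochastic_process M \<xi> \<and>
     (\<forall>t. integrable M (\<lambda>\<omega>. exp (\<xi> t \<omega>))) \<and>
     (\<forall>(N :: 'b measure) X U. brown_resnick_realisation M \<xi> N X U \<longrightarrow>
        stationary_process N (brown_resnick_sup X U))"

end

theory Submission
  imports Defs
begin

text \<open>
  The finite-dimensional distribution functions of the supremum are
  \<open>P (\<forall>j. \<eta> (t j) \<le> y j) = exp (- \<Lambda>)\<close>, where
  \<open>\<Lambda> = \<integral> exp (- u) P (\<exists>j. u + \<xi> (t j) > y j) du\<close>: conditionally on the Poisson points
  the copies are independent, and the expectation of the resulting product over the points is the
  Laplace functional of the Poisson process.

  To see that \<open>\<Lambda>\<close> is translation invariant, substitute \<open>u - \<xi> s\<close> for \<open>u\<close> at an arbitrary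
  reference point \<open>s\<close>.  This produces the density \<open>exp (\<xi> s) = exp (W s - Var (W s) / 2)\<close>, and
  tilting a Gaussian process by it shifts the increment \<open>W t - W s\<close> by its covariance with
  \<open>W s\<close>.  The drifts combine to \<open>- Var (W t - W s) / 2\<close>, so \<open>\<Lambda>\<close> depends only on the law
  of the increments relative to \<open>s\<close>.  Choosing \<open>s = 0\<close> for the original points and
  \<open>s = h\<close> for the points shifted by \<open>h\<close> gives the same value.
\<close>

section \<open>Uniqueness of joint laws\<close>

text \<open>Three features of the hypotheses shape the proof. \<open>gaussian_process\<close>
  prescribes only the laws of single linear combinations, while the tilt needs the joint law of
  \<open>S\<close> and several residuals. Independence therefore has to come from comparing
  characteristic functions of all linear combinations on \<open>M\<close> with those on a product
  space, which calls for a uniqueness theorem in several dimensions.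

  \<open>poisson_point_process\<close> prescribes only counts, and their laws only on sets of finite
  intensity, while \<open>exp_intensity\<close> has infinite total mass. The product over all points
  is therefore computed for step functions with support of finite intensity and then reached by
  approximation from below. This needs \<Lambda> to be finite, which is itself a consequence of the
  choice of reference point.

  Finally, \<open>W 0\<close> is not assumed to vanish, and stationarity of increments says nothing
  about how the law of \<open>W (t + h)\<close> relates to that of \<open>W t\<close>. So even the
  unshifted process has to be recentred, at \<open>0\<close>, before the two intensities can be
  compared.\<close>

lemma law_eq_of_char_eq:
  fixes X :: "'a \<Rightarrow> real" and Y :: "'b \<Rightarrow> real"
  assumes "prob_space M" "prob_space N"
    and [measurable]: "X \<in> borel_measurable M" "Y \<in> borel_measurable N"
    and eq: "\<And>u. (CLINT \<omega>|M. iexp (u * X \<omega>)) = (CLINT \<omega>|N. iexp (u * Y \<omega>))"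
  shows "distr M borel X = distr N borel Y"
proof -
  interpret M: prob_space M by fact
  interpret N: prob_space N by fact
  show ?thesis
    by (rule Levy_uniqueness) (auto simp: char_def fun_eq_iff integral_distr eq simp del: of_real_mult)
qed

lemma weighted_law_eq_real:
  fixes X :: "'a \<Rightarrow> real" and Y :: "'b \<Rightarrow> real"
    and f :: "'a \<Rightarrow> real" and g :: "'b \<Rightarrow> real"
  assumes M: "prob_space M" and N: "prob_space N"
    and [measurable]: "X \<in> borel_measurable M" "Y \<in> borel_measurable N"
      "f \<in> borel_measurable M" "g \<in> borel_measurable N"
    and f: "\<And>\<omega>. \<bar>f \<omega>\<bar> \<le> 1" and g: "\<And>\<omega>. \<bar>g \<omega>\<bar> \<le> 1"
    and eq: "\<And>u. (CLINT \<omega>|M. iexp (u * X \<omega>)) = (CLINT \<omega>|N. iexp (u * Y \<omega>))"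
    and eqw: "\<And>u. (CLINT \<omega>|M. f \<omega> * iexp (u * X \<omega>)) = (CLINT \<omega>|N. g \<omega> * iexp (u * Y \<omega>))"
    and [measurable]: "B \<in> sets borel"
  shows "(LINT \<omega>|M. indicator B (X \<omega>) * f \<omega>) = (LINT \<omega>|N. indicator B (Y \<omega>) * g \<omega>)"
proof -
  interpret M: prob_space M by fact
  interpret N: prob_space N by fact
  have [simp, intro]: "integrable M f" "integrable N g"
    using f g by (auto intro!: M.integrable_const_bound[of _ 1] N.integrable_const_bound[of _ 1])
  \<comment> \<open>\<open>c\<close> is the total mass of \<open>2 + f\<close>. It is at least 1,
    whereas the mass of \<open>1 + f\<close> could vanish. The case \<open>u = 0\<close> of
    \<open>eqw\<close> shows that \<open>2 + g\<close> has the same normalising constant.\<close>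
  define c where "c = 2 + (LINT \<omega>|M. f \<omega>)"
  have "(CLINT \<omega>|M. complex_of_real (f \<omega>)) = (CLINT \<omega>|N. complex_of_real (g \<omega>))"
    using eqw[of 0] by simp
  then have "(LINT \<omega>|M. f \<omega>) = (LINT \<omega>|N. g \<omega>)"
    by (simp only: integral_complex_of_real of_real_eq_iff)
  then have cN: "c = 2 + (LINT \<omega>|N. g \<omega>)"
    by (simp add: c_def)
  have "\<bar>LINT \<omega>|M. f \<omega>\<bar> \<le> 1"
  proof -
    have "\<bar>LINT \<omega>|M. f \<omega>\<bar> \<le> (LINT \<omega>|M. \<bar>f \<omega>\<bar>)" by (rule integral_abs_bound)
    also have "\<dots> \<le> (LINT \<omega>|M. 1)" using f by (intro integral_mono) auto
    finally show ?thesis by (simp add: M.prob_space)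
  qed
  then have c: "c > 0" by (simp add: c_def)
  have f2': "\<bar>f \<omega>\<bar> \<le> 2" for \<omega> using f[of \<omega>] by simp
  have g2': "\<bar>g \<omega>\<bar> \<le> 2" for \<omega> using g[of \<omega>] by simp
  have f2: "0 \<le> (2 + f \<omega>) / c" for \<omega> using f[of \<omega>] c by (auto simp: abs_le_iff)
  have g2: "0 \<le> (2 + g \<omega>) / c" for \<omega> using g[of \<omega>] c by (auto simp: abs_le_iff)
  \<comment> \<open>The weight \<open>2 + f\<close> is positive, so Levy uniqueness applies to the weighted laws; the constant part is then subtracted.\<close>
  define M' where "M' = density M (\<lambda>\<omega>. (2 + f \<omega>) / c)"
  define N' where "N' = density N (\<lambda>\<omega>. (2 + g \<omega>) / c)"
  have meas[measurable_cong, simp]: "sets M' = sets M" "sets N' = sets N"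
    by (auto simp: M'_def N'_def)
  have "prob_space M'"
  proof
    have "emeasure M' (space M') = (\<integral>\<^sup>+\<omega>. (2 + f \<omega>) / c \<partial>M)"
      by (auto simp: M'_def emeasure_density intro!: nn_integral_cong)
    also have "\<dots> = ennreal (LINT \<omega>|M. (2 + f \<omega>) / c)"
      using f2 by (intro nn_integral_eq_integral) auto
    also have "(LINT \<omega>|M. (2 + f \<omega>) / c) = 1"
      using c by (simp add: c_def M.prob_space)
    finally show "emeasure M' (space M') = 1" by simp
  qed
  moreover have "prob_space N'"
  proof
    have "emeasure N' (space N') = (\<integral>\<^sup>+\<omega>. (2 + g \<omega>) / c \<partial>N)"
      by (auto simp: N'_def emeasure_density intro!: nn_integral_cong)
    also have "\<dots> = ennreal (LINT \<omega>|N. (2 + g \<omega>) / c)"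
      using g2 by (intro nn_integral_eq_integral) auto
    also have "(LINT \<omega>|N. (2 + g \<omega>) / c) = 1"
      using c by (simp add: cN N.prob_space)
    finally show "emeasure N' (space N') = 1" by simp
  qed
  moreover have "(CLINT \<omega>|M'. iexp (u * X \<omega>)) = (CLINT \<omega>|N'. iexp (u * Y \<omega>))" for u
  proof -
    have "(CLINT \<omega>|M'. iexp (u * X \<omega>)) = (CLINT \<omega>|M. ((2 + f \<omega>) / c) *\<^sub>R iexp (u * X \<omega>))"
      unfolding M'_def using f2 by (intro integral_density) auto
    also have "\<dots> = (CLINT \<omega>|M. (2 * iexp (u * X \<omega>) + f \<omega> * iexp (u * X \<omega>)) / c)"
      by (intro Bochner_Integration.integral_cong) (auto simp: scaleR_conv_of_real algebra_simps add_divide_distrib)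
    also have "\<dots> = (2 * (CLINT \<omega>|M. iexp (u * X \<omega>)) + (CLINT \<omega>|M. f \<omega> * iexp (u * X \<omega>))) / c"
      using f2' by (subst integral_divide_zero, subst Bochner_Integration.integral_add)
        (auto intro!: M.integrable_const_bound[of _ 2] simp: norm_mult)
    finally have 1: "(CLINT \<omega>|M'. iexp (u * X \<omega>)) = \<dots>" .
    have "(CLINT \<omega>|N'. iexp (u * Y \<omega>)) = (CLINT \<omega>|N. ((2 + g \<omega>) / c) *\<^sub>R iexp (u * Y \<omega>))"
      unfolding N'_def using g2 by (intro integral_density) auto
    also have "\<dots> = (CLINT \<omega>|N. (2 * iexp (u * Y \<omega>) + g \<omega> * iexp (u * Y \<omega>)) / c)"
      by (intro Bochner_Integration.integral_cong) (auto simp: scaleR_conv_of_real algebra_simps add_divide_distrib)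
    also have "\<dots> = (2 * (CLINT \<omega>|N. iexp (u * Y \<omega>)) + (CLINT \<omega>|N. g \<omega> * iexp (u * Y \<omega>))) / c"
      using g2' by (subst integral_divide_zero, subst Bochner_Integration.integral_add)
        (auto intro!: N.integrable_const_bound[of _ 2] simp: norm_mult)
    finally show ?thesis by (simp only: 1 eq eqw)
  qed
  ultimately have 1: "distr M' borel X = distr N' borel Y"
    by (intro law_eq_of_char_eq) auto
  have 0: "distr M borel X = distr N borel Y"
    by (intro law_eq_of_char_eq M N eq) auto
  have iM: "integrable M (\<lambda>\<omega>. indicator B (X \<omega>) * f \<omega>)" "integrable M (\<lambda>\<omega>. indicator B (X \<omega>) :: real)"
    using f by (auto intro!: M.integrable_const_bound[of _ 1] split: split_indicator)
  have iN: "integrable N (\<lambda>\<omega>. indicator B (Y \<omega>) * g \<omega>)" "integrable N (\<lambda>\<omega>. indicator B (Y \<omega>) :: real)"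
    using g by (auto intro!: N.integrable_const_bound[of _ 1] split: split_indicator)
  have "(LINT x|distr M borel X. indicator B x :: real) = (LINT x|distr N borel Y. indicator B x)"
    by (simp only: 0)
  then have e0: "(LINT \<omega>|M. indicator B (X \<omega>) :: real) = (LINT \<omega>|N. indicator B (Y \<omega>))"
    by (simp add: integral_distr del: Bochner_Integration.integral_indicator)
  have "(LINT x|distr M' borel X. indicator B x :: real) = (LINT x|distr N' borel Y. indicator B x)"
    by (simp only: 1)
  then have "(LINT \<omega>|M'. indicator B (X \<omega>) :: real) = (LINT \<omega>|N'. indicator B (Y \<omega>))"
    by (simp add: integral_distr del: Bochner_Integration.integral_indicator)
  moreover have "(LINT \<omega>|M'. indicator B (X \<omega>) :: real) =
      (LINT \<omega>|M. (2 * indicator B (X \<omega>) + indicator B (X \<omega>) * f \<omega>) / c)"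
    unfolding M'_def using f2 by (subst integral_density) (auto simp: algebra_simps add_divide_distrib intro!: Bochner_Integration.integral_cong)
  moreover have "\<dots> = (2 * (LINT \<omega>|M. indicator B (X \<omega>)) + (LINT \<omega>|M. indicator B (X \<omega>) * f \<omega>)) / c"
    using iM by (subst integral_divide_zero, subst Bochner_Integration.integral_add) (auto simp del: Bochner_Integration.integral_indicator)
  moreover have "(LINT \<omega>|N'. indicator B (Y \<omega>) :: real) =
      (LINT \<omega>|N. (2 * indicator B (Y \<omega>) + indicator B (Y \<omega>) * g \<omega>) / c)"
    unfolding N'_def using g2 by (subst integral_density) (auto simp: algebra_simps add_divide_distrib intro!: Bochner_Integration.integral_cong)
  moreover have "\<dots> = (2 * (LINT \<omega>|N. indicator B (Y \<omega>)) + (LINT \<omega>|N. indicator B (Y \<omega>) * g \<omega>)) / c"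
    using iN by (subst integral_divide_zero, subst Bochner_Integration.integral_add) (auto simp del: Bochner_Integration.integral_indicator)
  ultimately show ?thesis using c e0 by simp
qed

text \<open>Real and imaginary parts of the weight are treated separately. The hypothesis for the
  conjugate weight comes for free: conjugate the equation at frequency \<open>-u\<close>. Complex
  weights are needed because the weight will contain the characters of other coordinates.\<close>

lemma weighted_law_eq:
  fixes X :: "'a \<Rightarrow> real" and Y :: "'b \<Rightarrow> real"
    and f :: "'a \<Rightarrow> complex" and g :: "'b \<Rightarrow> complex"
  assumes M: "prob_space M" and N: "prob_space N"
    and [measurable]: "X \<in> borel_measurable M" "Y \<in> borel_measurable N"
      "f \<in> borel_measurable M" "g \<in> borel_measurable N"
    and f: "\<And>\<omega>. cmod (f \<omega>) \<le> 1" and g: "\<And>\<omega>. cmod (g \<omega>) \<le> 1"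
    and eq: "\<And>u. (CLINT \<omega>|M. iexp (u * X \<omega>)) = (CLINT \<omega>|N. iexp (u * Y \<omega>))"
    and eqw: "\<And>u. (CLINT \<omega>|M. f \<omega> * iexp (u * X \<omega>)) = (CLINT \<omega>|N. g \<omega> * iexp (u * Y \<omega>))"
    and [measurable]: "B \<in> sets borel"
  shows "(CLINT \<omega>|M. indicator B (X \<omega>) * f \<omega>) = (CLINT \<omega>|N. indicator B (Y \<omega>) * g \<omega>)"
proof -
  interpret M: prob_space M by fact
  interpret N: prob_space N by fact
  have cnj_iexp: "cnj (iexp x) = iexp (- x)" for x :: real
    by (simp add: exp_cnj)
  have eqc: "(CLINT \<omega>|M. cnj (f \<omega>) * iexp (u * X \<omega>)) = (CLINT \<omega>|N. cnj (g \<omega>) * iexp (u * Y \<omega>))" for u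
  proof -
    have "cnj (CLINT \<omega>|M. f \<omega> * iexp (- u * X \<omega>)) = cnj (CLINT \<omega>|N. g \<omega> * iexp (- u * Y \<omega>))"
      by (simp only: eqw)
    then show ?thesis
      unfolding Bochner_Integration.integral_cnj[symmetric] complex_cnj_mult cnj_iexp by simp
  qed
  have [measurable]: "cnj \<in> borel_measurable borel"
    by (intro borel_measurable_continuous_onI continuous_intros)
  have int: "integrable M (\<lambda>\<omega>. f \<omega> * iexp (u * X \<omega>))" "integrable M (\<lambda>\<omega>. cnj (f \<omega>) * iexp (u * X \<omega>))"
    "integrable N (\<lambda>\<omega>. g \<omega> * iexp (u * Y \<omega>))" "integrable N (\<lambda>\<omega>. cnj (g \<omega>) * iexp (u * Y \<omega>))" for u
    using f g by (auto intro!: M.integrable_const_bound[of _ 1] N.integrable_const_bound[of _ 1] simp: norm_mult)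
  have re: "complex_of_real (Re z) = (z + cnj z) / 2" and im: "complex_of_real (Im z) = (z - cnj z) / (2 * \<i>)" for z
    by (simp_all add: complex_eq_iff)
  have eqR: "(CLINT \<omega>|M. Re (f \<omega>) * iexp (u * X \<omega>)) = (CLINT \<omega>|N. Re (g \<omega>) * iexp (u * Y \<omega>))" for u
  proof -
    have "(CLINT \<omega>|M. Re (f \<omega>) * iexp (u * X \<omega>)) =
        (CLINT \<omega>|M. (f \<omega> * iexp (u * X \<omega>) + cnj (f \<omega>) * iexp (u * X \<omega>)) / 2)"
      by (simp only: re) (simp add: field_simps)
    also have "\<dots> = (CLINT \<omega>|N. (g \<omega> * iexp (u * Y \<omega>) + cnj (g \<omega>) * iexp (u * Y \<omega>)) / 2)"
      by (simp only: integral_divide_zero Bochner_Integration.integral_add int eqw eqc)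
    also have "\<dots> = (CLINT \<omega>|N. Re (g \<omega>) * iexp (u * Y \<omega>))"
      by (simp only: re) (simp add: field_simps)
    finally show ?thesis .
  qed
  have eqI: "(CLINT \<omega>|M. Im (f \<omega>) * iexp (u * X \<omega>)) = (CLINT \<omega>|N. Im (g \<omega>) * iexp (u * Y \<omega>))" for u
  proof -
    have "(CLINT \<omega>|M. Im (f \<omega>) * iexp (u * X \<omega>)) =
        (CLINT \<omega>|M. (f \<omega> * iexp (u * X \<omega>) - cnj (f \<omega>) * iexp (u * X \<omega>)) / (2 * \<i>))"
      by (simp only: im) (simp add: field_simps)
    also have "\<dots> = (CLINT \<omega>|N. (g \<omega> * iexp (u * Y \<omega>) - cnj (g \<omega>) * iexp (u * Y \<omega>)) / (2 * \<i>))"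
      by (simp only: integral_divide_zero Bochner_Integration.integral_diff int eqw eqc)
    also have "\<dots> = (CLINT \<omega>|N. Im (g \<omega>) * iexp (u * Y \<omega>))"
      by (simp only: im) (simp add: field_simps)
    finally show ?thesis .
  qed
  have R: "(LINT \<omega>|M. indicator B (X \<omega>) * Re (f \<omega>)) = (LINT \<omega>|N. indicator B (Y \<omega>) * Re (g \<omega>))"
    by (intro weighted_law_eq_real M N eq eqR order_trans[OF abs_Re_le_cmod] f g) auto
  have I: "(LINT \<omega>|M. indicator B (X \<omega>) * Im (f \<omega>)) = (LINT \<omega>|N. indicator B (Y \<omega>) * Im (g \<omega>))"
    by (intro weighted_law_eq_real M N eq eqI order_trans[OF abs_Im_le_cmod] f g) auto
  have iM: "complex_integrable M (\<lambda>\<omega>. indicator B (X \<omega>) * f \<omega>)" "complex_integrable N (\<lambda>\<omega>. indicator B (Y \<omega>) * g \<omega>)"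
    using f g by (auto intro!: M.integrable_const_bound[of _ 1] N.integrable_const_bound[of _ 1] split: split_indicator)
  have ind: "Re (indicator A x * z) = indicator A x * Re z" "Im (indicator A x * z) = indicator A x * Im z"
    for A :: "real set" and x z by (auto split: split_indicator)
  show ?thesis
    using R I iM by (simp add: complex_eq_iff integral_Re[symmetric] integral_Im[symmetric] ind
        del: integral_Re integral_Im times_complex.sel)
qed

text \<open>Fourier uniqueness in several dimensions reduces to one dimension through weights: while
  one coordinate is treated, all the others act as a weight of modulus at most 1.\<close>

lemma joint_law_eq_of_char_eq:
  fixes X :: "'i \<Rightarrow> 'a \<Rightarrow> real" and Y :: "'i \<Rightarrow> 'b \<Rightarrow> real"
  assumes M: "prob_space M" and N: "prob_space N" and I: "finite I"
    and X: "\<And>i. i \<in> I \<Longrightarrow> X i \<in> borel_measurable M"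
    and Y: "\<And>i. i \<in> I \<Longrightarrow> Y i \<in> borel_measurable N"
    and eq: "\<And>c. (CLINT \<omega>|M. iexp (\<Sum>i\<in>I. c i * X i \<omega>)) = (CLINT \<omega>|N. iexp (\<Sum>i\<in>I. c i * Y i \<omega>))"
  shows "distr M (PiM I (\<lambda>_. borel)) (\<lambda>\<omega>. \<lambda>i\<in>I. X i \<omega>) = distr N (PiM I (\<lambda>_. borel)) (\<lambda>\<omega>. \<lambda>i\<in>I. Y i \<omega>)"
proof -
  interpret M: prob_space M by fact
  interpret N: prob_space N by fact
  note [measurable] = X Y
  \<comment> \<open>Characters are replaced by indicators one coordinate at a time.\<close>
  have partial: "(CLINT \<omega>|M. (\<Prod>i\<in>K. indicator (B i) (X i \<omega>)) * iexp (\<Sum>i\<in>I - K. c i * X i \<omega>)) =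
        (CLINT \<omega>|N. (\<Prod>i\<in>K. indicator (B i) (Y i \<omega>)) * iexp (\<Sum>i\<in>I - K. c i * Y i \<omega>))"
    if "K \<subseteq> I" and B: "\<And>i. i \<in> I \<Longrightarrow> B i \<in> sets borel" for K B c
    using finite_subset[OF \<open>K \<subseteq> I\<close> I] \<open>K \<subseteq> I\<close>
  proof (induction K arbitrary: c rule: finite_induct)
    case empty
    then show ?case using eq by simp
  next
    case (insert k K)
    from insert.hyps insert.prems have k: "k \<in> I" "k \<notin> K" and fin: "finite (I - K)" "finite K" and KI: "K \<subseteq> I" using I by auto
    have [measurable]: "B i \<in> sets borel" if "i \<in> K" for i using B[of i] KI that by blast
    have [measurable]: "X i \<in> borel_measurable M" "Y i \<in> borel_measurable N" if "i \<in> K" for i using X[of i] Y[of i] KI that by blast+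
    have [measurable]: "X k \<in> borel_measurable M" "Y k \<in> borel_measurable N" using X[of k] Y[of k] k by blast+
    have split: "(\<Sum>i\<in>I - K. (c(k := u)) i * Z i) = (\<Sum>i\<in>I - insert k K. c i * Z i) + u * Z k" for u and Z :: "'i \<Rightarrow> real"
    proof -
      have IK: "I - K = insert k (I - insert k K)" using k by auto
      have "(\<Sum>i\<in>I - insert k K. (c(k := u)) i * Z i) = (\<Sum>i\<in>I - insert k K. c i * Z i)"
        by (intro sum.cong) auto
      then show ?thesis using I by (subst IK) (simp add: add.commute)
    qed
    \<comment> \<open>\<open>f\<close> and \<open>g\<close> collect the contributions of all
      coordinates except \<open>k\<close>. The character of coordinate \<open>k\<close> with
      frequency \<open>u\<close> is exposed by the induction hypothesis at \<open>c(k := u)\<close>,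
      which is why \<open>c\<close> is left arbitrary in the induction.\<close>
    define f where "f \<omega> = (\<Prod>i\<in>K. indicator (B i) (X i \<omega>)) * iexp (\<Sum>i\<in>I - insert k K. c i * X i \<omega>)" for \<omega>
    define g where "g \<omega> = (\<Prod>i\<in>K. indicator (B i) (Y i \<omega>)) * iexp (\<Sum>i\<in>I - insert k K. c i * Y i \<omega>)" for \<omega>
    have "(CLINT \<omega>|M. indicator (B k) (X k \<omega>) * f \<omega>) = (CLINT \<omega>|N. indicator (B k) (Y k \<omega>) * g \<omega>)"
    proof (rule weighted_law_eq[OF M N])
      show "f \<in> borel_measurable M" "g \<in> borel_measurable N"
        unfolding f_def g_def using k by measurable
      have "cmod (\<Prod>i\<in>K. indicator (B i) (z i)) \<le> 1" for z
        by (intro order_trans[OF norm_prod_le] prod_le_1) (auto split: split_indicator)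
      then show "cmod (f \<omega>) \<le> 1" "cmod (g \<omega>') \<le> 1" for \<omega> \<omega>'
        by (simp_all add: f_def g_def norm_mult)
      show "(CLINT \<omega>|M. iexp (u * X k \<omega>)) = (CLINT \<omega>|N. iexp (u * Y k \<omega>))" for u
        using eq[of "\<lambda>i. if i = k then u else 0"] k I
        by (simp add: if_distrib[of "\<lambda>x. x * _"] sum.delta cong: if_cong del: of_real_mult)
      show "(CLINT \<omega>|M. f \<omega> * iexp (u * X k \<omega>)) = (CLINT \<omega>|N. g \<omega> * iexp (u * Y k \<omega>))" for u
        using insert.IH[OF KI, of "c(k := u)"] unfolding split
        by (simp add: f_def g_def mult.assoc exp_add[symmetric] distrib_left del: of_real_mult of_real_sum)
    qed (use k B in auto)
    then show ?case using insert.hyps by (simp add: f_def g_def mult.assoc)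
  qed
  show ?thesis
  proof (rule measure_eqI_PiM_finite[OF I])
    interpret dM: prob_space "distr M (PiM I (\<lambda>_. borel)) (\<lambda>\<omega>. \<lambda>i\<in>I. X i \<omega>)"
      by (intro M.prob_space_distr) measurable
    interpret dN: prob_space "distr N (PiM I (\<lambda>_. borel)) (\<lambda>\<omega>. \<lambda>i\<in>I. Y i \<omega>)"
      by (intro N.prob_space_distr) measurable
    fix B :: "'i \<Rightarrow> real set" assume B: "\<And>i. i \<in> I \<Longrightarrow> B i \<in> sets borel"
    have S: "Pi\<^sub>E I B \<in> sets (PiM I (\<lambda>_. borel))" using I B by (intro sets_PiM_I_finite) auto
    have ind: "(\<Prod>i\<in>I. indicator (B i) (z i) :: complex) = complex_of_real (indicator (Pi\<^sub>E I B) (\<lambda>i\<in>I. z i))" for z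
      using I by (auto simp: PiE_iff indicator_def prod_zero_iff extensional_def split: if_splits)
    \<comment> \<open>With \<open>K = I\<close> no character is left, so \<open>partial\<close>
      compares the probabilities of boxes.\<close>
    have "(CLINT \<omega>|M. complex_of_real (indicator (Pi\<^sub>E I B) (\<lambda>i\<in>I. X i \<omega>))) =
      (CLINT \<omega>|N. complex_of_real (indicator (Pi\<^sub>E I B) (\<lambda>i\<in>I. Y i \<omega>)))"
      using partial[of I B "\<lambda>_. 0"] B by (simp add: ind)
    then have "(LINT \<omega>|M. (indicat_real (Pi\<^sub>E I B) (\<lambda>i\<in>I. X i \<omega>))) =
      (LINT \<omega>|N. (indicat_real (Pi\<^sub>E I B) (\<lambda>i\<in>I. Y i \<omega>)))"
      by (simp only: integral_complex_of_real of_real_eq_iff)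
    moreover have "(LINT \<omega>|M. (indicat_real (Pi\<^sub>E I B) (\<lambda>i\<in>I. X i \<omega>))) =
      measure (distr M (PiM I (\<lambda>_. borel)) (\<lambda>\<omega>. \<lambda>i\<in>I. X i \<omega>)) (Pi\<^sub>E I B)"
      using S by (subst integral_distr[symmetric, where N="PiM I (\<lambda>_. borel)"]) auto
    moreover have "(LINT \<omega>|N. (indicat_real (Pi\<^sub>E I B) (\<lambda>i\<in>I. Y i \<omega>))) =
      measure (distr N (PiM I (\<lambda>_. borel)) (\<lambda>\<omega>. \<lambda>i\<in>I. Y i \<omega>)) (Pi\<^sub>E I B)"
      using S by (subst integral_distr[symmetric, where N="PiM I (\<lambda>_. borel)"]) auto
    ultimately show "emeasure (distr M (PiM I (\<lambda>_. borel)) (\<lambda>\<omega>. \<lambda>i\<in>I. X i \<omega>)) (Pi\<^sub>E I B) =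
      emeasure (distr N (PiM I (\<lambda>_. borel)) (\<lambda>\<omega>. \<lambda>i\<in>I. Y i \<omega>)) (Pi\<^sub>E I B)"
      by (simp add: dM.emeasure_eq_measure dN.emeasure_eq_measure)
  next
    interpret dM: prob_space "distr M (PiM I (\<lambda>_. borel)) (\<lambda>\<omega>. \<lambda>i\<in>I. X i \<omega>)"
      by (intro M.prob_space_distr) measurable
    show "range (\<lambda>_::nat. \<Pi>\<^sub>E i\<in>I. UNIV) \<subseteq> prod_algebra I (\<lambda>_. borel)"
      using I by (auto intro!: prod_algebraI_finite)
    show "(\<Union>i::nat. \<Pi>\<^sub>E i\<in>I. UNIV) = space (PiM I (\<lambda>_. borel :: real measure))" by (simp add: space_PiM)
    show "emeasure (distr M (PiM I (\<lambda>_. borel)) (\<lambda>\<omega>. \<lambda>i\<in>I. X i \<omega>)) (\<Pi>\<^sub>E i\<in>I. UNIV) \<noteq> \<infinity>" for i :: nat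
      by simp
  qed auto
qed

section \<open>Distribution functions of extended-real vectors\<close>

lemma borel_eq_sigma_atMost:
  "(borel :: 'a :: {linorder_topology, second_countable_topology} measure) = sigma UNIV (range atMost)"
proof (rule borel_eq_sigmaI1[OF borel_Ioi])
  fix X :: "'a set" assume "X \<in> range greaterThan"
  then obtain a where "X = {a<..}" by auto
  then have "X = UNIV - {..a}" by auto
  then show "X \<in> sets (sigma UNIV (range atMost))"
    using sigma_sets.Compl[OF sigma_sets.Basic, of "{..a}" "range atMost" UNIV] by simp
qed auto

text \<open>Products of the sets \<open>{..c i}\<close> are closed under intersection and generate
  the product sigma-algebra. Since the bound \<infinity> is allowed, the whole space is one of them,
  so no exhausting sequence of finite bounds is required.\<close>

lemma joint_law_eq_of_cdf_eq:
  fixes X :: "'i \<Rightarrow> 'a \<Rightarrow> ereal" and Y :: "'i \<Rightarrow> 'b \<Rightarrow> ereal"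
  assumes M: "prob_space M" and N: "prob_space N" and I: "finite I"
    and X: "\<And>i. i \<in> I \<Longrightarrow> X i \<in> borel_measurable M"
    and Y: "\<And>i. i \<in> I \<Longrightarrow> Y i \<in> borel_measurable N"
    and eq: "\<And>c. measure M {\<omega> \<in> space M. \<forall>i\<in>I. X i \<omega> \<le> c i} = measure N {\<omega> \<in> space N. \<forall>i\<in>I. Y i \<omega> \<le> c i}"
  shows "distr M (PiM I (\<lambda>_. borel)) (\<lambda>\<omega>. \<lambda>i\<in>I. X i \<omega>) = distr N (PiM I (\<lambda>_. borel)) (\<lambda>\<omega>. \<lambda>i\<in>I. Y i \<omega>)"
proof -
  interpret M: prob_space M by fact
  interpret N: prob_space N by fact
  note [measurable] = X Y
  interpret dM: prob_space "distr M (PiM I (\<lambda>_. borel)) (\<lambda>\<omega>. \<lambda>i\<in>I. X i \<omega>)"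
    by (intro M.prob_space_distr) measurable
  interpret dN: prob_space "distr N (PiM I (\<lambda>_. borel)) (\<lambda>\<omega>. \<lambda>i\<in>I. Y i \<omega>)"
    by (intro N.prob_space_distr) measurable
  define E where "E = {Pi\<^sub>E I (\<lambda>i. {..c i}) | c :: 'i \<Rightarrow> ereal. True}"
  have "sets (PiM I (\<lambda>_. sigma UNIV (range atMost) :: ereal measure)) =
      sets (sigma (\<Pi>\<^sub>E i\<in>I. UNIV) {{f \<in> \<Pi>\<^sub>E i\<in>I. UNIV. \<forall>i\<in>j. f i \<in> A i} | A j. j \<in> {I} \<and> A \<in> Pi j (\<lambda>_. range atMost)})"
    by (rule sets_PiM_sigma) (auto simp: I intro!: exI[of _ "{{..\<infinity>}}"])
  also have "{{f \<in> \<Pi>\<^sub>E i\<in>I. UNIV. \<forall>i\<in>j. f i \<in> A i} | A j. j \<in> {I} \<and> A \<in> Pi j (\<lambda>_. range (atMost :: ereal \<Rightarrow> _))} = E"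
  proof (intro set_eqI iffI)
    fix S assume "S \<in> {{f \<in> \<Pi>\<^sub>E i\<in>I. UNIV. \<forall>i\<in>j. f i \<in> A i} | A j. j \<in> {I} \<and> A \<in> Pi j (\<lambda>_. range (atMost :: ereal \<Rightarrow> _))}"
    then obtain A where A: "S = {f \<in> \<Pi>\<^sub>E i\<in>I. UNIV. \<forall>i\<in>I. f i \<in> A i}" "\<forall>i\<in>I. \<exists>c. A i = {..c}"
      by (auto simp: Pi_iff image_iff)
    then obtain c where "\<forall>i\<in>I. A i = {..c i}" by metis
    with A have "S = Pi\<^sub>E I (\<lambda>i. {..c i})" by (auto simp: PiE_iff extensional_def)
    then show "S \<in> E" by (auto simp: E_def)
  next
    fix S assume "S \<in> E"
    then obtain c where "S = Pi\<^sub>E I (\<lambda>i. {..c i})" by (auto simp: E_def)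
    then show "S \<in> {{f \<in> \<Pi>\<^sub>E i\<in>I. UNIV. \<forall>i\<in>j. f i \<in> A i} | A j. j \<in> {I} \<and> A \<in> Pi j (\<lambda>_. range (atMost :: ereal \<Rightarrow> _))}"
      by (intro CollectI exI[of _ "\<lambda>i. {..c i}"] exI[of _ I]) (auto simp: PiE_iff extensional_def)
  qed
  also have "sets (sigma (\<Pi>\<^sub>E i\<in>I. UNIV) E) = sigma_sets (\<Pi>\<^sub>E i\<in>I. UNIV) E"
    by (rule sets_measure_of) (auto simp: E_def PiE_iff)
  finally have sets: "sets (PiM I (\<lambda>_. borel :: ereal measure)) = sigma_sets (\<Pi>\<^sub>E i\<in>I. UNIV) E"
    by (simp only: borel_eq_sigma_atMost[symmetric])
  show ?thesis
  proof (rule measure_eqI_generator_eq)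
    show "Int_stable E"
    proof (rule Int_stableI)
      fix A B assume "A \<in> E" "B \<in> E"
      then obtain c d where "A = Pi\<^sub>E I (\<lambda>i. {..c i})" "B = Pi\<^sub>E I (\<lambda>i. {..d i})" by (auto simp: E_def)
      then have "A \<inter> B = Pi\<^sub>E I (\<lambda>i. {..min (c i) (d i)})" by (auto simp: PiE_iff)
      then show "A \<inter> B \<in> E" by (auto simp: E_def)
    qed
    show "E \<subseteq> Pow (\<Pi>\<^sub>E i\<in>I. UNIV)" by (auto simp: E_def PiE_iff)
    fix S assume "S \<in> E"
    then obtain c where S: "S = Pi\<^sub>E I (\<lambda>i. {..c i})" by (auto simp: E_def)
    have [measurable]: "S \<in> sets (PiM I (\<lambda>_. borel))"
      unfolding S by (rule sets_PiM_I_finite[OF I]) auto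
    have "measure (distr M (PiM I (\<lambda>_. borel)) (\<lambda>\<omega>. \<lambda>i\<in>I. X i \<omega>)) S = measure M {\<omega> \<in> space M. \<forall>i\<in>I. X i \<omega> \<le> c i}"
      by (subst measure_distr) (auto simp: S PiE_iff intro!: sets_PiM_I_finite I arg_cong[where f="measure M"])
    moreover have "measure (distr N (PiM I (\<lambda>_. borel)) (\<lambda>\<omega>. \<lambda>i\<in>I. Y i \<omega>)) S = measure N {\<omega> \<in> space N. \<forall>i\<in>I. Y i \<omega> \<le> c i}"
      by (subst measure_distr) (auto simp: S PiE_iff intro!: sets_PiM_I_finite I arg_cong[where f="measure N"])
    ultimately show "emeasure (distr M (PiM I (\<lambda>_. borel)) (\<lambda>\<omega>. \<lambda>i\<in>I. X i \<omega>)) S =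
        emeasure (distr N (PiM I (\<lambda>_. borel)) (\<lambda>\<omega>. \<lambda>i\<in>I. Y i \<omega>)) S"
      by (simp add: dM.emeasure_eq_measure dN.emeasure_eq_measure eq)
  next
    show "range (\<lambda>_::nat. \<Pi>\<^sub>E i\<in>I. {..\<infinity>}) \<subseteq> E" by (auto simp: E_def)
    show "(\<Union>i::nat. \<Pi>\<^sub>E i\<in>I. {..\<infinity>}) = (\<Pi>\<^sub>E i\<in>I. UNIV :: ereal set)" by (auto simp: PiE_iff)
  qed (auto simp: sets)
qed

section \<open>Exponential tilting of Gaussian processes\<close>

text \<open>Affine images of a standard normal variable include the point mass at
  \<open>\<sigma> = 0\<close>, so moments, characteristic function and tilt need no case distinction
  afterwards.\<close>

lemma normal_law_eq_distr:
  assumes "0 \<le> \<sigma>"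
  shows "normal_law \<mu> \<sigma> = distr std_normal_distribution borel (\<lambda>x. \<mu> + \<sigma> * x)"
proof (cases "\<sigma> = 0")
  case True
  interpret real_distribution std_normal_distribution by (rule real_dist_normal_dist)
  show ?thesis using True by (auto simp: normal_law_def intro!: distr_const[symmetric])
next
  case False
  interpret real_distribution std_normal_distribution by (rule real_dist_normal_dist)
  have "distributed std_normal_distribution lborel (\<lambda>x. x) std_normal_density"
    by (simp add: distributed_def distr_id2)
  from normal_density_affine[OF this, of \<sigma> \<mu>] False assms show ?thesis
    by (simp add: normal_law_def distributed_def cong: distr_cong)
qed

text \<open>Completing the square: the factor
  \<open>exp (\<sigma> * x - \<sigma>\<^sup>2 / 2)\<close> translates the standard normal density by
  \<sigma>, hence the scaled variable \<open>\<sigma> * x\<close> by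
  \<open>\<sigma>\<^sup>2\<close>. This is the one-dimensional Cameron-Martin formula.\<close>

lemma std_normal_tilt:
  assumes [measurable]: "h \<in> borel_measurable borel" and "0 \<le> \<sigma>"
  shows "(\<integral>\<^sup>+x. ennreal (exp (\<sigma> * x - \<sigma>\<^sup>2 / 2)) * h (\<sigma> * x) \<partial>std_normal_distribution) =
    (\<integral>\<^sup>+x. h (\<sigma> * x + \<sigma>\<^sup>2) \<partial>std_normal_distribution)"
proof -
  have d: "std_normal_density (\<sigma> + x) * exp (\<sigma> * (\<sigma> + x) - \<sigma>\<^sup>2 / 2) = std_normal_density x" for x
    by (simp add: std_normal_density_def exp_add[symmetric] power2_eq_square field_simps)
  have "(\<integral>\<^sup>+x. ennreal (exp (\<sigma> * x - \<sigma>\<^sup>2 / 2)) * h (\<sigma> * x) \<partial>std_normal_distribution) =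
      (\<integral>\<^sup>+x. ennreal (std_normal_density x) * (ennreal (exp (\<sigma> * x - \<sigma>\<^sup>2 / 2)) * h (\<sigma> * x)) \<partial>lborel)"
    by (subst nn_integral_density) auto
  also have "\<dots> = (\<integral>\<^sup>+x. ennreal (std_normal_density (\<sigma> + x)) *
      (ennreal (exp (\<sigma> * (\<sigma> + x) - \<sigma>\<^sup>2 / 2)) * h (\<sigma> * (\<sigma> + x))) \<partial>lborel)"
    by (subst nn_integral_real_affine[where c=1 and t=\<sigma>]) auto
  also have "\<dots> = (\<integral>\<^sup>+x. ennreal (std_normal_density x) * h (\<sigma> * x + \<sigma>\<^sup>2) \<partial>lborel)"
    by (simp add: mult.assoc[symmetric] ennreal_mult'[symmetric] d)
       (simp add: algebra_simps power2_eq_square)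
  also have "\<dots> = (\<integral>\<^sup>+x. h (\<sigma> * x + \<sigma>\<^sup>2) \<partial>std_normal_distribution)"
    by (subst nn_integral_density) auto
  finally show ?thesis .
qed

lemma normal_law_zero_tilt:
  assumes [measurable]: "h \<in> borel_measurable borel" and "0 \<le> \<sigma>"
  shows "(\<integral>\<^sup>+s. ennreal (exp (s - \<sigma>\<^sup>2 / 2)) * h s \<partial>normal_law 0 \<sigma>) = (\<integral>\<^sup>+s. h (s + \<sigma>\<^sup>2) \<partial>normal_law 0 \<sigma>)"
  using std_normal_tilt[OF assms] assms(2) by (simp add: normal_law_eq_distr nn_integral_distr)

lemma normal_law_moments:
  assumes "0 \<le> \<sigma>"
  shows "integrable (normal_law \<mu> \<sigma>) (\<lambda>x. x)" "(LINT x|normal_law \<mu> \<sigma>. x) = \<mu>"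
    "integrable (normal_law 0 \<sigma>) (\<lambda>x. x\<^sup>2)" "(LINT x|normal_law 0 \<sigma>. x\<^sup>2) = \<sigma>\<^sup>2"
    "(CLINT x|normal_law 0 \<sigma>. iexp (u * x)) = exp (- (u\<^sup>2 * \<sigma>\<^sup>2 / 2))"
proof -
  interpret real_distribution std_normal_distribution by (rule real_dist_normal_dist)
  have i: "integrable std_normal_distribution (\<lambda>x. x)" "(LINT x|std_normal_distribution. x) = 0"
    using integrable_std_normal_distribution_moment[of 1] integral_std_normal_distribution_moment_odd[of 1] by auto
  have i2: "integrable std_normal_distribution (\<lambda>x. x\<^sup>2)" "(LINT x|std_normal_distribution. x\<^sup>2) = 1"
  proof -
    show "integrable std_normal_distribution (\<lambda>x. x\<^sup>2)" by (rule integrable_std_normal_distribution_moment)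
    have "(LINT x|std_normal_distribution. x\<^sup>2) = fact 2 / (2 ^ 1 * fact 1)"
      by (rule std_normal_distribution_even_moments(1)[of 1, unfolded mult_1_right])
    also have "\<dots> = 1" by simp
    finally show "(LINT x|std_normal_distribution. x\<^sup>2) = 1" .
  qed
  have m: "(\<lambda>x. a + \<sigma> * x) \<in> measurable std_normal_distribution borel" for a by simp
  show "integrable (normal_law \<mu> \<sigma>) (\<lambda>x. x)"
    unfolding normal_law_eq_distr[OF assms]
    by (subst integrable_distr_eq[OF m]) (auto intro!: i(1))
  have "(LINT x|normal_law \<mu> \<sigma>. x) = (LINT x|std_normal_distribution. \<mu> + \<sigma> * x)"
    unfolding normal_law_eq_distr[OF assms] by (subst integral_distr[OF m]) auto
  also have "\<dots> = (LINT x|std_normal_distribution. \<mu>) + (LINT x|std_normal_distribution. \<sigma> * x)"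
    by (intro Bochner_Integration.integral_add integrable_mult_right i(1)) simp
  also have "\<dots> = \<mu>"
    by (subst integral_mult_right_zero, subst i(2), subst lebesgue_integral_const, subst prob_space) simp
  finally show "(LINT x|normal_law \<mu> \<sigma>. x) = \<mu>" .
  show "integrable (normal_law 0 \<sigma>) (\<lambda>x. x\<^sup>2)"
    unfolding normal_law_eq_distr[OF assms]
    by (subst integrable_distr_eq[OF m]) (auto intro!: i2(1) simp: power_mult_distrib)
  have "(LINT x|normal_law 0 \<sigma>. x\<^sup>2) = (LINT x|std_normal_distribution. \<sigma>\<^sup>2 * x\<^sup>2)"
    unfolding normal_law_eq_distr[OF assms]
    by (subst integral_distr[OF m]) (auto simp: power_mult_distrib)
  also have "\<dots> = \<sigma>\<^sup>2"
    by (subst integral_mult_right_zero) (simp only: i2 mult_1_right)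
  finally show "(LINT x|normal_law 0 \<sigma>. x\<^sup>2) = \<sigma>\<^sup>2" .
  show "(CLINT x|normal_law 0 \<sigma>. iexp (u * x)) = exp (- (u\<^sup>2 * \<sigma>\<^sup>2 / 2))"
    using assms fun_cong[OF char_std_normal_distribution, of "u * \<sigma>"]
    by (simp add: normal_law_eq_distr integral_distr char_def power_mult_distrib mult.assoc exp_of_real)
qed

section \<open>The linear span of a centred Gaussian process\<close>

locale centred_gaussian_process =
  fixes M :: "'a measure" and W :: "'t \<Rightarrow> 'a \<Rightarrow> real"
  assumes gaussian: "gaussian_process M W" and centred: "zero_mean M W"
begin

sublocale prob_space M
  using gaussian by (simp add: gaussian_process_def stochastic_process_def)

text \<open>These are the variables whose laws \<open>gaussian_process\<close> controls. The span is
  stable under linear combinations, so it contains the increments of \<open>W\<close> and the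
  residuals left after subtracting a multiple of a fixed element.\<close>

definition gaussian_span :: "('a \<Rightarrow> real) set" where
  "gaussian_span = {Y. \<exists>J c. finite J \<and> Y = (\<lambda>\<omega>. \<Sum>t\<in>J. c t * W t \<omega>)}"

lemma W_measurable [measurable]: "W t \<in> borel_measurable M"
  using gaussian by (simp add: gaussian_process_def stochastic_process_def)

lemma span_W: "W t \<in> gaussian_span"
  unfolding gaussian_span_def by (intro CollectI exI[of _ "{t}"] exI[of _ "\<lambda>_. 1"]) auto

lemma span_scale:
  assumes "Y \<in> gaussian_span"
  shows "(\<lambda>\<omega>. a * Y \<omega>) \<in> gaussian_span"
proof -
  obtain J c where "finite J" "Y = (\<lambda>\<omega>. \<Sum>t\<in>J. c t * W t \<omega>)"
    using assms unfolding gaussian_span_def by auto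
  then show ?thesis
    unfolding gaussian_span_def
    by (intro CollectI exI[of _ J] exI[of _ "\<lambda>t. a * c t"]) (simp add: sum_distrib_left mult.assoc)
qed

lemma span_add:
  assumes "Y \<in> gaussian_span" "Z \<in> gaussian_span"
  shows "(\<lambda>\<omega>. Y \<omega> + Z \<omega>) \<in> gaussian_span"
proof -
  from assms obtain J c K d where *: "finite J" "finite K"
    "Y = (\<lambda>\<omega>. \<Sum>t\<in>J. c t * W t \<omega>)" "Z = (\<lambda>\<omega>. \<Sum>t\<in>K. d t * W t \<omega>)"
    unfolding gaussian_span_def by auto
  \<comment> \<open>The index sets may overlap, so both coefficient families are extended by zero to
    the union and added there.\<close>
  let ?e = "\<lambda>t. (if t \<in> J then c t else 0) + (if t \<in> K then d t else 0)"
  have "Y \<omega> + Z \<omega> = (\<Sum>t\<in>J \<union> K. ?e t * W t \<omega>)" for \<omega>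
  proof -
    have "Y \<omega> = (\<Sum>t\<in>J \<union> K. if t \<in> J then c t * W t \<omega> else 0)"
      using * by (simp add: sum.If_cases Int_absorb1)
    moreover have "Z \<omega> = (\<Sum>t\<in>J \<union> K. if t \<in> K then d t * W t \<omega> else 0)"
      using * by (simp add: sum.If_cases Int_absorb1)
    ultimately show ?thesis
      by (simp add: sum.distrib[symmetric] distrib_right if_distrib[of "\<lambda>x. x * _"] cong: if_cong)
  qed
  then show ?thesis
    using * unfolding gaussian_span_def by (intro CollectI exI[of _ "J \<union> K"] exI[of _ ?e]) auto
qed

lemma span_diff: "Y \<in> gaussian_span \<Longrightarrow> Z \<in> gaussian_span \<Longrightarrow> (\<lambda>\<omega>. Y \<omega> - Z \<omega>) \<in> gaussian_span"
  using span_add[of Y "\<lambda>\<omega>. -1 * Z \<omega>"] span_scale[of Z "-1"] by simp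

lemma span_zero: "(\<lambda>\<omega>. 0) \<in> gaussian_span"
  unfolding gaussian_span_def by (intro CollectI exI[of _ "{}"]) auto

lemma span_sum:
  assumes "\<And>i. i \<in> I \<Longrightarrow> Y i \<in> gaussian_span"
  shows "(\<lambda>\<omega>. \<Sum>i\<in>I. c i * Y i \<omega>) \<in> gaussian_span"
  using assms
proof (induction I rule: infinite_finite_induct)
  case (insert i I)
  then have "(\<lambda>\<omega>. c i * Y i \<omega> + (\<Sum>i\<in>I. c i * Y i \<omega>)) \<in> gaussian_span"
    by (intro span_add[of "\<lambda>\<omega>. c i * Y i \<omega>"] span_scale) auto
  then show ?case using insert.hyps by simp
qed (auto intro: span_zero)

lemma span_measurable: "Y \<in> gaussian_span \<Longrightarrow> Y \<in> borel_measurable M"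
  unfolding gaussian_span_def by auto

lemma span_law_ex:
  assumes "Y \<in> gaussian_span"
  obtains \<mu> \<sigma> where "0 \<le> \<sigma>" "distr M borel Y = normal_law \<mu> \<sigma>"
  using assms gaussian unfolding gaussian_span_def gaussian_process_def by blast

lemma span_integrable:
  assumes "Y \<in> gaussian_span"
  shows "integrable M Y"
proof -
  note [measurable] = span_measurable[OF assms]
  obtain \<mu> \<sigma> where *: "0 \<le> \<sigma>" "distr M borel Y = normal_law \<mu> \<sigma>"
    using span_law_ex[OF assms] .
  have "integrable (distr M borel Y) (\<lambda>x. x)"
    unfolding * by (rule normal_law_moments(1)[OF *(1)])
  then show ?thesis by (subst (asm) integrable_distr_eq) auto
qed

lemma span_expectation:
  assumes "Y \<in> gaussian_span"
  shows "expectation Y = 0"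
proof -
  obtain J c where Y: "finite J" "Y = (\<lambda>\<omega>. \<Sum>t\<in>J. c t * W t \<omega>)"
    using assms unfolding gaussian_span_def by auto
  have "expectation Y = (\<Sum>t\<in>J. c t * expectation (W t))"
    unfolding Y by (simp add: Bochner_Integration.integral_sum span_integrable[OF span_W])
  then show ?thesis using centred by (simp add: zero_mean_def)
qed

text \<open>The parameters in \<open>gaussian_process\<close> are only asserted to exist; the first
  two moments identify them. From here on the law of an element of the span is a function of its
  second moment alone.\<close>

lemma span_square:
  assumes "Y \<in> gaussian_span"
  shows "integrable M (\<lambda>\<omega>. (Y \<omega>)\<^sup>2)"
    and "distr M borel Y = normal_law 0 (sqrt (expectation (\<lambda>\<omega>. (Y \<omega>)\<^sup>2)))"
proof -
  note [measurable] = span_measurable[OF assms]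
  obtain \<mu> \<sigma> where *: "0 \<le> \<sigma>" "distr M borel Y = normal_law \<mu> \<sigma>"
    using span_law_ex[OF assms] .
  have "\<mu> = (LINT x|distr M borel Y. x)"
    unfolding * by (rule normal_law_moments(2)[OF *(1), symmetric])
  also have "\<dots> = 0"
    by (subst integral_distr) (auto simp: span_expectation[OF assms])
  finally have law: "distr M borel Y = normal_law 0 \<sigma>" using * by simp
  have "integrable (distr M borel Y) (\<lambda>x. x\<^sup>2)"
    unfolding law by (rule normal_law_moments(3)[OF *(1)])
  then show "integrable M (\<lambda>\<omega>. (Y \<omega>)\<^sup>2)" by (subst (asm) integrable_distr_eq) auto
  have "\<sigma>\<^sup>2 = (LINT x|distr M borel Y. x\<^sup>2)"
    unfolding law by (rule normal_law_moments(4)[OF *(1), symmetric])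
  also have "\<dots> = expectation (\<lambda>\<omega>. (Y \<omega>)\<^sup>2)"
    by (subst integral_distr) auto
  finally have "sqrt (expectation (\<lambda>\<omega>. (Y \<omega>)\<^sup>2)) = \<sigma>" using *(1) by (metis real_sqrt_unique)
  with law show "distr M borel Y = normal_law 0 (sqrt (expectation (\<lambda>\<omega>. (Y \<omega>)\<^sup>2)))" by simp
qed

lemma span_char:
  assumes "Y \<in> gaussian_span"
  shows "(CLINT \<omega>|M. iexp (Y \<omega>)) = exp (- (expectation (\<lambda>\<omega>. (Y \<omega>)\<^sup>2) / 2))"
proof -
  note [measurable] = span_measurable[OF assms]
  have nn: "0 \<le> expectation (\<lambda>\<omega>. (Y \<omega>)\<^sup>2)" by simp
  have "(CLINT \<omega>|M. iexp (Y \<omega>)) = (CLINT x|distr M borel Y. iexp (1 * x))"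
    by (subst integral_distr) auto
  also have "\<dots> = exp (- (expectation (\<lambda>\<omega>. (Y \<omega>)\<^sup>2) / 2))"
    unfolding span_square(2)[OF assms] using nn by (subst normal_law_moments(5)) auto
  finally show ?thesis .
qed

text \<open>Polarisation: a product is a combination of squares of elements of the span.\<close>

lemma span_mult_integrable:
  assumes "Y \<in> gaussian_span" "Z \<in> gaussian_span"
  shows "integrable M (\<lambda>\<omega>. Y \<omega> * Z \<omega>)"
proof -
  have "(\<lambda>\<omega>. Y \<omega> * Z \<omega>) = (\<lambda>\<omega>. ((Y \<omega> + Z \<omega>)\<^sup>2 - (Y \<omega>)\<^sup>2 - (Z \<omega>)\<^sup>2) / 2)"
    by (auto simp: power2_eq_square algebra_simps)
  then show ?thesis using span_square(1)[OF span_add[OF assms]] assms[THEN span_square(1)] by simp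
qed

text \<open>
  Write \<open>V j = R j + a j * S\<close> with \<open>R\<close> uncorrelated with, hence independent of, \<open>S\<close>:
  the joint law of \<open>(S, R)\<close> is realised on the product space \<open>M \<Otimes>\<^sub>M M\<close>, where the tilt only
  acts on the second factor.
\<close>

lemma span_tilt:
  assumes S: "S \<in> gaussian_span" and V: "\<And>j. j \<in> J \<Longrightarrow> V j \<in> gaussian_span" and J: "finite J"
    and F [measurable]: "F \<in> borel_measurable (PiM J (\<lambda>_. borel))"
  shows "(\<integral>\<^sup>+\<omega>. ennreal (exp (S \<omega> - expectation (\<lambda>\<omega>. (S \<omega>)\<^sup>2) / 2)) * F (\<lambda>j\<in>J. V j \<omega>) \<partial>M) =
    (\<integral>\<^sup>+\<omega>. F (\<lambda>j\<in>J. V j \<omega> + expectation (\<lambda>\<omega>. V j \<omega> * S \<omega>)) \<partial>M)"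
proof -
  define v where "v = expectation (\<lambda>\<omega>. (S \<omega>)\<^sup>2)"
  have v: "0 \<le> v" by (simp add: v_def)
  note [measurable] = span_measurable[OF S]
  \<comment> \<open>If \<open>v = 0\<close>, division by zero makes \<open>a j = 0\<close>, which is the right value since then \<open>S\<close> vanishes almost surely.\<close>
  define a where "a j = expectation (\<lambda>\<omega>. V j \<omega> * S \<omega>) / v" for j
  have av: "a j * v = expectation (\<lambda>\<omega>. V j \<omega> * S \<omega>)" if j: "j \<in> J" for j
  proof (cases "v = 0")
    case True
    then have "AE \<omega> in M. (S \<omega>)\<^sup>2 = 0"
      using integral_nonneg_eq_0_iff_AE[OF span_square(1)[OF S]] by (simp add: v_def)
    then have "AE \<omega> in M. V j \<omega> * S \<omega> = 0" by eventually_elim simp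
    then have "expectation (\<lambda>\<omega>. V j \<omega> * S \<omega>) = expectation (\<lambda>\<omega>. 0)"
      using span_measurable[OF V[OF j]] by (intro integral_cong_AE) auto
    with True show ?thesis by simp
  qed (simp add: a_def)
  define R where "R j \<omega> = V j \<omega> - a j * S \<omega>" for j \<omega>
  have R: "R j \<in> gaussian_span" if "j \<in> J" for j
    unfolding R_def[abs_def] by (intro span_diff span_scale V S that)
  note [measurable] = span_measurable[OF R] span_measurable[OF V]
  have RS: "expectation (\<lambda>\<omega>. R j \<omega> * S \<omega>) = 0" if "j \<in> J" for j
  proof -
    have "expectation (\<lambda>\<omega>. R j \<omega> * S \<omega>) = expectation (\<lambda>\<omega>. V j \<omega> * S \<omega> - a j * (S \<omega>)\<^sup>2)"
      by (simp add: R_def algebra_simps power2_eq_square)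
    also have "\<dots> = expectation (\<lambda>\<omega>. V j \<omega> * S \<omega>) - a j * v"
      using that by (simp add: v_def span_mult_integrable V S span_square(1))
    finally show ?thesis using av[OF that] by simp
  qed
  \<comment> \<open>The index \<open>None\<close> carries \<open>S\<close> and \<open>Some j\<close>
    carries \<open>R j\<close>. In \<open>Z'\<close> only \<open>S\<close> is read from the second
    factor, which makes it independent of the residuals.\<close>
  define I where "I = insert None (Some ` J)"
  define Z where "Z = (\<lambda>i \<omega>. case i of None \<Rightarrow> S \<omega> | Some j \<Rightarrow> R j \<omega>)"
  define Z' where "Z' = (\<lambda>i (\<omega>, \<omega>'). case i of None \<Rightarrow> S \<omega>' | Some j \<Rightarrow> R j \<omega>)"
  interpret MM: pair_prob_space M M ..
  have Zm [measurable]: "Z i \<in> borel_measurable M" if "i \<in> I" for i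
    using that by (auto simp: Z_def I_def)
  have Zm' [measurable]: "Z' i \<in> borel_measurable (M \<Otimes>\<^sub>M M)" if "i \<in> I" for i
    using that by (auto simp: Z'_def I_def split_beta)
  have Z_sum: "(\<Sum>i\<in>I. c i * f i) = c None * f None + (\<Sum>j\<in>J. c (Some j) * f (Some j))" for c f :: "'b option \<Rightarrow> real"
    using J by (simp add: I_def sum.reindex)
  have law: "distr M (PiM I (\<lambda>_. borel)) (\<lambda>\<omega>. \<lambda>i\<in>I. Z i \<omega>) = distr (M \<Otimes>\<^sub>M M) (PiM I (\<lambda>_. borel)) (\<lambda>\<omega>. \<lambda>i\<in>I. Z' i \<omega>)"
  proof (rule joint_law_eq_of_char_eq)
    show "finite I" using J by (simp add: I_def)
    fix c :: "'b option \<Rightarrow> real"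
    define T where "T \<omega> = (\<Sum>j\<in>J. c (Some j) * R j \<omega>)" for \<omega>
    have T: "T \<in> gaussian_span" unfolding T_def[abs_def] by (intro span_sum R)
    have cS: "(\<lambda>\<omega>. c None * S \<omega>) \<in> gaussian_span" by (intro span_scale S)
    note [measurable] = span_measurable[OF T]
    have TS: "expectation (\<lambda>\<omega>. (c None * S \<omega>) * T \<omega>) = 0"
    proof -
      have "expectation (\<lambda>\<omega>. (c None * S \<omega>) * T \<omega>) = expectation (\<lambda>\<omega>. \<Sum>j\<in>J. (c None * c (Some j)) * (R j \<omega> * S \<omega>))"
        by (simp add: T_def sum_distrib_left mult_ac)
      also have "\<dots> = (\<Sum>j\<in>J. (c None * c (Some j)) * expectation (\<lambda>\<omega>. R j \<omega> * S \<omega>))"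
        by (subst Bochner_Integration.integral_sum) (auto intro!: span_mult_integrable R S)
      finally show ?thesis by (simp add: RS)
    qed
    have sq: "expectation (\<lambda>\<omega>. (c None * S \<omega> + T \<omega>)\<^sup>2) =
        expectation (\<lambda>\<omega>. (c None * S \<omega>)\<^sup>2) + expectation (\<lambda>\<omega>. (T \<omega>)\<^sup>2)"
    proof -
      have "expectation (\<lambda>\<omega>. (c None * S \<omega> + T \<omega>)\<^sup>2) =
        expectation (\<lambda>\<omega>. ((c None * S \<omega>)\<^sup>2 + (T \<omega>)\<^sup>2) + 2 * ((c None * S \<omega>) * T \<omega>))"
        by (intro Bochner_Integration.integral_cong) (auto simp: power2_eq_square algebra_simps)
      also have "\<dots> = expectation (\<lambda>\<omega>. (c None * S \<omega>)\<^sup>2) + expectation (\<lambda>\<omega>. (T \<omega>)\<^sup>2) + 2 * expectation (\<lambda>\<omega>. (c None * S \<omega>) * T \<omega>)"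
        using span_square(1)[OF cS] span_square(1)[OF T] span_mult_integrable[OF cS T]
        by (subst Bochner_Integration.integral_add, simp, simp, subst Bochner_Integration.integral_add) auto
      finally show ?thesis by (simp only: TS)
    qed
    \<comment> \<open>Without a cross term the Gaussian characteristic function factorises, and a
      product of two expectations is a single integral over the product space.\<close>
    have "(CLINT \<omega>|M. iexp (\<Sum>i\<in>I. c i * Z i \<omega>)) = (CLINT \<omega>|M. iexp (c None * S \<omega> + T \<omega>))"
      by (simp only: Z_sum) (simp add: Z_def T_def)
    also have "\<dots> = exp (- ((expectation (\<lambda>\<omega>. (c None * S \<omega>)\<^sup>2) + expectation (\<lambda>\<omega>. (T \<omega>)\<^sup>2)) / 2))"
      by (subst span_char[OF span_add[OF cS T]]) (simp only: sq)
    also have "\<dots> = (CLINT \<omega>|M. iexp (T \<omega>)) * (CLINT \<omega>|M. iexp (c None * S \<omega>))"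
      unfolding span_char[OF cS] span_char[OF T]
      by (simp only: of_real_mult[symmetric] exp_add[symmetric] of_real_eq_iff) (simp add: add_divide_distrib)
    also have "\<dots> = (CLINT \<omega>|M. (CLINT \<omega>'|M. iexp (T \<omega>) * iexp (c None * S \<omega>')))"
      by (simp only: integral_mult_right_zero integral_mult_left_zero)
    also have "\<dots> = (CLINT z|M \<Otimes>\<^sub>M M. iexp (T (fst z)) * iexp (c None * S (snd z)))"
      by (subst MM.integral_fst'[symmetric])
         (auto intro!: MM.P.integrable_const_bound[of _ 1] simp: norm_mult)
    also have "\<dots> = (CLINT z|M \<Otimes>\<^sub>M M. iexp (\<Sum>i\<in>I. c i * Z' i z))"
      unfolding Z_sum
      by (simp only: exp_add[symmetric] distrib_left[symmetric] of_real_add[symmetric])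
         (simp add: Z'_def T_def split_beta add.commute)
    finally show "(CLINT \<omega>|M. iexp (\<Sum>i\<in>I. c i * Z i \<omega>)) = (CLINT z|M \<Otimes>\<^sub>M M. iexp (\<Sum>i\<in>I. c i * Z' i z))" .
  qed (auto intro: prob_space_axioms MM.P.prob_space_axioms)
  have fold: "(\<integral>\<^sup>+\<omega>. H (\<lambda>i\<in>I. Z i \<omega>) \<partial>M) = (\<integral>\<^sup>+\<omega>. \<integral>\<^sup>+\<omega>'. H (\<lambda>i\<in>I. Z' i (\<omega>, \<omega>')) \<partial>M \<partial>M)"
    if [measurable]: "H \<in> borel_measurable (PiM I (\<lambda>_. borel))" for H :: "_ \<Rightarrow> ennreal"
  proof -
    have "(\<integral>\<^sup>+\<omega>. H (\<lambda>i\<in>I. Z i \<omega>) \<partial>M) = (\<integral>\<^sup>+z. H z \<partial>distr M (PiM I (\<lambda>_. borel)) (\<lambda>\<omega>. \<lambda>i\<in>I. Z i \<omega>))"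
      by (subst nn_integral_distr) auto
    also have "\<dots> = (\<integral>\<^sup>+z. H (\<lambda>i\<in>I. Z' i z) \<partial>(M \<Otimes>\<^sub>M M))"
      unfolding law by (subst nn_integral_distr) auto
    also have "\<dots> = (\<integral>\<^sup>+\<omega>. \<integral>\<^sup>+\<omega>'. H (\<lambda>i\<in>I. Z' i (\<omega>, \<omega>')) \<partial>M \<partial>M)"
      by (subst nn_integral_fst[symmetric]) auto
    finally show ?thesis .
  qed
  have [measurable]: "(\<lambda>z. z None) \<in> borel_measurable (PiM I (\<lambda>_. borel :: real measure))"
    "j \<in> J \<Longrightarrow> (\<lambda>z. z (Some j)) \<in> borel_measurable (PiM I (\<lambda>_. borel :: real measure))" for j
    by (auto simp: I_def intro!: measurable_component_singleton)
  have tilt1: "(\<integral>\<^sup>+\<omega>'. ennreal (exp (S \<omega>' - v / 2)) * h (S \<omega>') \<partial>M) = (\<integral>\<^sup>+\<omega>'. h (S \<omega>' + v) \<partial>M)"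
    if [measurable]: "h \<in> borel_measurable borel" for h
  proof -
    have "(\<integral>\<^sup>+\<omega>'. ennreal (exp (S \<omega>' - v / 2)) * h (S \<omega>') \<partial>M) =
        (\<integral>\<^sup>+s. ennreal (exp (s - v / 2)) * h s \<partial>distr M borel S)"
      by (subst nn_integral_distr) auto
    also have "\<dots> = (\<integral>\<^sup>+s. h (s + v) \<partial>distr M borel S)"
      unfolding span_square(2)[OF S] using normal_law_zero_tilt[OF that, of "sqrt v"] v by (simp add: v_def)
    also have "\<dots> = (\<integral>\<^sup>+\<omega>'. h (S \<omega>' + v) \<partial>M)"
      by (subst nn_integral_distr) auto
    finally show ?thesis .
  qed
  have "(\<integral>\<^sup>+\<omega>. ennreal (exp (S \<omega> - v / 2)) * F (\<lambda>j\<in>J. V j \<omega>) \<partial>M) =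
      (\<integral>\<^sup>+\<omega>. (\<lambda>z. ennreal (exp (z None - v / 2)) * F (\<lambda>j\<in>J. z (Some j) + a j * z None)) (\<lambda>i\<in>I. Z i \<omega>) \<partial>M)"
    by (intro nn_integral_cong) (auto simp: Z_def I_def R_def intro!: arg_cong2[where f="(*)"] arg_cong[where f=F])
  also have "\<dots> = (\<integral>\<^sup>+\<omega>. \<integral>\<^sup>+\<omega>'. ennreal (exp (S \<omega>' - v / 2)) * F (\<lambda>j\<in>J. R j \<omega> + a j * S \<omega>') \<partial>M \<partial>M)"
    by (subst fold, measurable)
       (auto simp: Z'_def I_def intro!: nn_integral_cong arg_cong2[where f="(*)"] arg_cong[where f=F])
  \<comment> \<open>Once the first variable \<omega> is frozen, the residuals are constants and only
    the one-dimensional law of \<open>S\<close> is tilted.\<close>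
  also have "\<dots> = (\<integral>\<^sup>+\<omega>. \<integral>\<^sup>+\<omega>'. F (\<lambda>j\<in>J. R j \<omega> + a j * (S \<omega>' + v)) \<partial>M \<partial>M)"
  proof (rule nn_integral_cong)
    fix \<omega>
    have "(\<lambda>s. F (\<lambda>j\<in>J. R j \<omega> + a j * s)) \<in> borel_measurable borel" by measurable
    from tilt1[OF this] show "(\<integral>\<^sup>+\<omega>'. ennreal (exp (S \<omega>' - v / 2)) * F (\<lambda>j\<in>J. R j \<omega> + a j * S \<omega>') \<partial>M) =
      (\<integral>\<^sup>+\<omega>'. F (\<lambda>j\<in>J. R j \<omega> + a j * (S \<omega>' + v)) \<partial>M)" .
  qed
  also have "\<dots> = (\<integral>\<^sup>+\<omega>. (\<lambda>z. F (\<lambda>j\<in>J. z (Some j) + a j * (z None + v))) (\<lambda>i\<in>I. Z i \<omega>) \<partial>M)"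
  proof -
    have "(\<lambda>z. F (\<lambda>j\<in>J. z (Some j) + a j * (z None + v))) \<in> borel_measurable (PiM I (\<lambda>_. borel))"
      by measurable
    from fold[OF this] show ?thesis
      by (auto simp: Z'_def I_def intro!: nn_integral_cong arg_cong[where f=F])
  qed
  \<comment> \<open>Translating \<open>S\<close> by \<open>v\<close> moves \<open>V j\<close> by
    \<open>a j * v\<close>, which \<open>av\<close> identifies as the covariance of
    \<open>V j\<close> and \<open>S\<close>.\<close>
  also have "\<dots> = (\<integral>\<^sup>+\<omega>. F (\<lambda>j\<in>J. V j \<omega> + expectation (\<lambda>\<omega>. V j \<omega> * S \<omega>)) \<partial>M)"
  proof (rule nn_integral_cong)
    fix \<omega>
    have "(\<lambda>j\<in>J. V j \<omega> + expectation (\<lambda>\<omega>. V j \<omega> * S \<omega>)) = (\<lambda>j\<in>J. Z (Some j) \<omega> + a j * (Z None \<omega> + v))"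
      by (rule restrict_ext, subst av[symmetric], simp) (simp add: Z_def R_def algebra_simps)
    then show "F (\<lambda>j\<in>J. (\<lambda>i\<in>I. Z i \<omega>) (Some j) + a j * ((\<lambda>i\<in>I. Z i \<omega>) None + v)) =
        F (\<lambda>j\<in>J. V j \<omega> + expectation (\<lambda>\<omega>. V j \<omega> * S \<omega>))"
      by (simp add: I_def cong: restrict_cong)
  qed
  finally show ?thesis unfolding v_def .
qed

end

section \<open>The product functional of a Poisson process\<close>

lemma card_eq_suminf_indicator:
  assumes "(\<Sum>i. indicator S i :: ennreal) = of_nat c"
  shows "finite S" "card S = c"
proof -
  have "(\<Sum>i. indicator S i :: ennreal) = emeasure (count_space UNIV) S"
    by (simp add: nn_integral_count_space_nat[symmetric])
  with assms have *: "emeasure (count_space UNIV) S = of_nat c" by simp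
  then show "finite S"
    by (metis emeasure_count_space_infinite ennreal_of_nat_neq_top infinity_ennreal_def subset_UNIV)
  with * show "card S = c" by simp
qed

text \<open>The Poisson weights sum to 1, so the count is almost surely a natural number, where
  \<phi> takes the intended value \<open>q ^ k\<close>. The expectation is then the generating
  function of the Poisson law at \<open>q\<close>.\<close>

lemma (in prob_space) poisson_count_pgf:
  fixes C :: "'a \<Rightarrow> ennreal"
  assumes [measurable]: "C \<in> borel_measurable M"
    and C: "\<And>k. prob {\<omega> \<in> space M. C \<omega> = of_nat k} = l ^ k / fact k * exp (- l)"
    and q: "0 \<le> q" "q \<le> 1" and l: "0 \<le> l"
  defines "\<phi> \<equiv> \<lambda>x :: ennreal. q ^ nat \<lfloor>enn2real x\<rfloor>"
  shows "AE \<omega> in M. \<exists>k. C \<omega> = of_nat k" "expectation (\<lambda>\<omega>. \<phi> (C \<omega>)) = exp (- (l * (1 - q)))"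
proof -
  define P where "P k = {\<omega> \<in> space M. C \<omega> = of_nat k}" for k :: nat
  have [measurable]: "P k \<in> sets M" for k by (simp add: P_def)
  have "disjoint_family P" by (auto simp: disjoint_family_on_def P_def)
  then have 1: "(\<lambda>k. prob (P k)) sums prob (\<Union>k. P k)"
    by (intro finite_measure_UNION) auto
  have e: "(\<lambda>k. x ^ k / fact k) sums exp x" for x :: real
    using exp_converges[of x] by (simp add: divide_inverse mult.commute)
  have "(\<lambda>k. l ^ k / fact k * exp (- l)) sums (exp l * exp (- l))"
    by (intro sums_mult2 e)
  with 1 have "prob (\<Union>k. P k) = 1"
    unfolding P_def C by (simp add: sums_iff exp_minus)
  then have "AE \<omega> in M. \<omega> \<in> (\<Union>k. P k)" by (intro AE_prob_1)
  then show ae: "AE \<omega> in M. \<exists>k. C \<omega> = of_nat k" by eventually_elim (auto simp: P_def)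
  have \<phi>_nat: "\<phi> (of_nat k) = q ^ k" for k
    by (simp add: \<phi>_def)
  have [measurable]: "\<phi> \<in> borel_measurable borel"
    unfolding \<phi>_def by measurable
  have "(\<integral>\<^sup>+\<omega>. ennreal (\<phi> (C \<omega>)) \<partial>M) = (\<integral>\<^sup>+\<omega>. (\<Sum>k. ennreal (q ^ k) * indicator (P k) \<omega>) \<partial>M)"
  proof (rule nn_integral_cong_AE)
    show "AE \<omega> in M. ennreal (\<phi> (C \<omega>)) = (\<Sum>k. ennreal (q ^ k) * indicator (P k) \<omega>)"
      using ae AE_space
    proof eventually_elim
      fix \<omega> assume "\<exists>k. C \<omega> = of_nat k" and \<omega>: "\<omega> \<in> space M"
      then obtain k where k: "C \<omega> = of_nat k" by auto
      have "(\<Sum>k. ennreal (q ^ k) * indicator (P k) \<omega>) = (\<Sum>j\<in>{k}. ennreal (q ^ j) * indicator (P j) \<omega>)"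
        using k by (intro suminf_finite) (auto simp: P_def)
      then show "ennreal (\<phi> (C \<omega>)) = (\<Sum>k. ennreal (q ^ k) * indicator (P k) \<omega>)"
        using k \<omega> by (simp add: P_def \<phi>_nat)
    qed
  qed
  also have "\<dots> = (\<Sum>k. \<integral>\<^sup>+\<omega>. ennreal (q ^ k) * indicator (P k) \<omega> \<partial>M)"
    by (intro nn_integral_suminf) auto
  also have "\<dots> = (\<Sum>k. ennreal (q ^ k * prob (P k)))"
    using q by (simp add: nn_integral_cmult_indicator emeasure_eq_measure ennreal_mult')
  also have "\<dots> = ennreal (exp (- (l * (1 - q))))"
  proof (rule suminf_ennreal_eq)
    have "(\<lambda>k. (q * l) ^ k / fact k * exp (- l)) sums (exp (q * l) * exp (- l))"
      by (intro sums_mult2 e)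
    moreover have "exp (q * l) * exp (- l) = exp (- (l * (1 - q)))"
      by (simp add: exp_add[symmetric] algebra_simps)
    moreover have "(q * l) ^ k / fact k * exp (- l) = q ^ k * prob (P k)" for k
      unfolding P_def C by (simp add: power_mult_distrib)
    ultimately show "(\<lambda>k. q ^ k * prob (P k)) sums exp (- (l * (1 - q)))" by simp
  qed (use q in auto)
  finally show "expectation (\<lambda>\<omega>. \<phi> (C \<omega>)) = exp (- (l * (1 - q)))"
    using q by (subst integral_eq_nn_integral) (auto simp: \<phi>_def)
qed

text \<open>Grouping the points by the value of \<open>f\<close> turns the product into the product
  of \<open>(1 - v k)\<close> raised to the number of points in the level set \<open>A k\<close>.
  The level sets are disjoint and of finite intensity, so these counts are independent Poisson
  variables and the expectation is a product of generating functions.\<close>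

lemma poisson_product_simple:
  fixes f :: "real \<Rightarrow> real"
  assumes P: "poisson_point_process N \<Lambda> U" and N: "prob_space N" and [measurable_cong]: "sets \<Lambda> = sets borel"
    and [measurable]: "f \<in> borel_measurable borel" and fin: "finite (range f)"
    and f: "\<And>x. 0 \<le> f x" "\<And>x. f x \<le> 1"
    and supp: "emeasure \<Lambda> {x. f x \<noteq> 0} < \<infinity>"
  shows "(\<lambda>m. LINT \<omega>|N. (\<Prod>i<m. 1 - f (U i \<omega>))) \<longlonglongrightarrow> exp (- (LINT x|\<Lambda>. f x))"
proof -
  interpret N: prob_space N by fact
  have [measurable]: "U i \<in> borel_measurable N" for i
    using P by (simp add: poisson_point_process_def stochastic_process_def)
  \<comment> \<open>The value 0 is left out: its level set may have infinite intensity, and its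
    points contribute only factors 1.\<close>
  obtain v :: "nat \<Rightarrow> real" and n where v: "bij_betw v {..<n} (range f - {0})"
    using ex_bij_betw_nat_finite[of "range f - {0}"] fin by (auto simp: atLeast0LessThan)
  have vk: "v k \<noteq> 0" "0 \<le> v k" "v k \<le> 1" if "k < n" for k
  proof -
    have "v k \<in> range f - {0}" using v that by (auto simp: bij_betw_def)
    then show "v k \<noteq> 0" "0 \<le> v k" "v k \<le> 1" using f by auto
  qed
  define A where "A k = f -` {v k}" for k
  have [measurable]: "A k \<in> sets borel" for k
    unfolding A_def by (rule measurable_sets_borel[of _ borel]) auto
  have disj: "disjoint_family_on A {..<n}"
    using v by (auto simp: disjoint_family_on_def A_def bij_betw_def inj_on_def)
  have finA: "emeasure \<Lambda> (A k) < \<infinity>" if "k < n" for k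
  proof -
    have "emeasure \<Lambda> (A k) \<le> emeasure \<Lambda> {x. f x \<noteq> 0}"
      using vk[OF that] by (intro emeasure_mono) (auto simp: A_def)
    then show ?thesis using supp by (rule order_le_less_trans)
  qed
  define C where "C k = point_count U (A k)" for k
  have C_eq: "C k \<omega> = (\<Sum>i. indicator {i. U i \<omega> \<in> A k} i)" for k \<omega>
    by (simp add: C_def point_count_def indicator_def)
  have [measurable]: "C k \<in> borel_measurable N" for k
    unfolding C_def point_count_def[abs_def] by measurable
  have pgf: "AE \<omega> in N. \<exists>c. C k \<omega> = of_nat c"
    "(LINT \<omega>|N. (1 - v k) ^ nat \<lfloor>enn2real (C k \<omega>)\<rfloor>) = exp (- (measure \<Lambda> (A k) * v k))" if "k < n" for k
  proof -
    have "N.prob {\<omega> \<in> space N. C k \<omega> = of_nat j} = measure \<Lambda> (A k) ^ j / fact j * exp (- measure \<Lambda> (A k))" for j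
      using P finA[OF that] by (auto simp: poisson_point_process_def C_def)
    from N.poisson_count_pgf[of "C k" "measure \<Lambda> (A k)" "1 - v k", OF _ this] vk[OF that]
    show "AE \<omega> in N. \<exists>c. C k \<omega> = of_nat c"
      "(LINT \<omega>|N. (1 - v k) ^ nat \<lfloor>enn2real (C k \<omega>)\<rfloor>) = exp (- (measure \<Lambda> (A k) * v k))"
      by simp_all
  qed
  have indep: "N.indep_vars (\<lambda>_. borel) C {..<n}"
    using P disj by (auto simp: poisson_point_process_def C_def[abs_def])
  define \<Phi> where "\<Phi> \<omega> = (\<Prod>k<n. (1 - v k) ^ nat \<lfloor>enn2real (C k \<omega>)\<rfloor>)" for \<omega>
  have bound: "\<bar>(1 - v k) ^ j\<bar> \<le> 1" if "k < n" for k j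
    using vk[OF that] by (auto simp: power_le_one)
  have "(LINT \<omega>|N. \<Phi> \<omega>) = (\<Prod>k<n. LINT \<omega>|N. (1 - v k) ^ nat \<lfloor>enn2real (C k \<omega>)\<rfloor>)"
    unfolding \<Phi>_def
  proof (rule N.indep_vars_lebesgue_integral)
    show "N.indep_vars (\<lambda>_. borel) (\<lambda>k \<omega>. (1 - v k) ^ nat \<lfloor>enn2real (C k \<omega>)\<rfloor>) {..<n}"
      by (rule N.indep_vars_compose2[OF indep]) measurable
    show "integrable N (\<lambda>\<omega>. (1 - v k) ^ nat \<lfloor>enn2real (C k \<omega>)\<rfloor>)" if "k \<in> {..<n}" for k
      using bound that by (intro N.integrable_const_bound[of _ 1]) auto
  qed auto
  also have "\<dots> = exp (\<Sum>k<n. - (measure \<Lambda> (A k) * v k))"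
    by (simp add: pgf(2) exp_sum)
  also have "(\<Sum>k<n. - (measure \<Lambda> (A k) * v k)) = - (LINT x|\<Lambda>. f x)"
  proof -
    have "f x = (\<Sum>k<n. v k * indicator (A k) x)" for x
    proof (cases "f x = 0")
      case True
      then show ?thesis using vk by (simp add: A_def indicator_def)
    next
      case False
      then obtain k where k: "k < n" "f x = v k"
        using v by (metis (no_types, lifting) DiffI bij_betw_imp_surj_on imageE lessThan_iff rangeI singletonD)
      have "(\<Sum>k<n. v k * indicator (A k) x) = (\<Sum>j\<in>{k}. v j * indicator (A j) x)"
        using k v by (intro sum.mono_neutral_right) (auto simp: A_def indicator_def bij_betw_def inj_on_def)
      then show ?thesis using k by (simp add: A_def)
    qed
    then have "(LINT x|\<Lambda>. f x) = (LINT x|\<Lambda>. (\<Sum>k<n. v k * indicator (A k) x))" by simp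
    also have "\<dots> = (\<Sum>k<n. v k * measure \<Lambda> (A k))"
      using finA by (subst Bochner_Integration.integral_sum) (auto simp: sets_eq_imp_space_eq[OF \<open>sets \<Lambda> = sets borel\<close>])
    finally show ?thesis by (simp add: sum_negf mult.commute)
  qed
  finally have \<Phi>: "(LINT \<omega>|N. \<Phi> \<omega>) = exp (- (LINT x|\<Lambda>. f x))" .
  have "(\<lambda>m. LINT \<omega>|N. (\<Prod>i<m. 1 - f (U i \<omega>))) \<longlonglongrightarrow> (LINT \<omega>|N. \<Phi> \<omega>)"
  proof (rule integral_dominated_convergence[where w="\<lambda>_. 1"])
    show "\<Phi> \<in> borel_measurable N" unfolding \<Phi>_def[abs_def] by measurable
    show "AE \<omega> in N. norm (\<Prod>i<m. 1 - f (U i \<omega>)) \<le> 1" for m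
      using f by (intro AE_I2 order_trans[OF norm_prod_le] prod_le_1) (auto simp: abs_le_iff)
    have "AE \<omega> in N. \<forall>k\<in>{..<n}. \<exists>c. C k \<omega> = of_nat c"
      by (intro AE_finite_allI pgf(1)) auto
    then show "AE \<omega> in N. (\<lambda>m. \<Prod>i<m. 1 - f (U i \<omega>)) \<longlonglongrightarrow> \<Phi> \<omega>"
    proof eventually_elim
      fix \<omega> assume "\<forall>k\<in>{..<n}. \<exists>c. C k \<omega> = of_nat c"
      then obtain c where c: "\<And>k. k < n \<Longrightarrow> C k \<omega> = of_nat (c k)" by (metis lessThan_iff)
      define S where "S k = {i. U i \<omega> \<in> A k}" for k
      have S: "finite (S k)" "card (S k) = c k" if "k < n" for k
        using card_eq_suminf_indicator[of "S k" "c k"] c[OF that] C_eq[of k \<omega>] by (auto simp: S_def)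
      have S_disj: "S i \<inter> S j = {}" if "i < n" "j < n" "i \<noteq> j" for i j
        using disj that unfolding disjoint_family_on_def S_def by blast
      have finS: "finite (\<Union>k<n. S k)" using S by auto
      \<comment> \<open>Only finitely many indices belong to points where \<open>f\<close> is
        nonzero. Beyond the largest of them the partial products are constant; inserting 0 keeps
        \<open>Max\<close> defined when there are none.\<close>
      have "\<forall>\<^sub>F m in sequentially. (\<Prod>i<m. 1 - f (U i \<omega>)) = \<Phi> \<omega>"
        using eventually_gt_at_top[of "Max (insert 0 (\<Union>k<n. S k))"]
      proof eventually_elim
        fix m assume m: "Max (insert 0 (\<Union>k<n. S k)) < m"
        have "f (U i \<omega>) = 0" if "i \<notin> (\<Union>k<n. S k)" for i
        proof (rule ccontr)
          assume "f (U i \<omega>) \<noteq> 0"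
          then obtain k where "k < n" "f (U i \<omega>) = v k"
            using v by (metis (no_types, lifting) DiffI bij_betw_imp_surj_on imageE lessThan_iff rangeI singletonD)
          with that show False by (auto simp: S_def A_def)
        qed
        moreover have "(\<Union>k<n. S k) \<subseteq> {..<m}"
          using m finS by (auto simp: Max_less_iff)
        ultimately have "(\<Prod>i<m. 1 - f (U i \<omega>)) = (\<Prod>i\<in>(\<Union>k<n. S k). 1 - f (U i \<omega>))"
          by (intro prod.mono_neutral_right) auto
        also have "\<dots> = (\<Prod>k<n. \<Prod>i\<in>S k. 1 - f (U i \<omega>))"
          using S S_disj by (intro prod.UNION_disjoint) auto
        also have "\<dots> = \<Phi> \<omega>"
          unfolding \<Phi>_def
        proof (rule prod.cong)
          fix k assume "k \<in> {..<n}"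
          then have "k < n" by simp
          have "(\<Prod>i\<in>S k. 1 - f (U i \<omega>)) = (\<Prod>i\<in>S k. 1 - v k)"
            by (intro prod.cong) (auto simp: S_def A_def)
          then show "(\<Prod>i\<in>S k. 1 - f (U i \<omega>)) = (1 - v k) ^ nat \<lfloor>enn2real (C k \<omega>)\<rfloor>"
            using S[OF \<open>k < n\<close>] c[OF \<open>k < n\<close>] by simp
        qed simp
        finally show "(\<Prod>i<m. 1 - f (U i \<omega>)) = \<Phi> \<omega>" .
      qed
      then show "(\<lambda>m. \<Prod>i<m. 1 - f (U i \<omega>)) \<longlonglongrightarrow> \<Phi> \<omega>"
        by (rule tendsto_eventually)
    qed
  qed auto
  then show ?thesis by (simp only: \<Phi>)
qed

text \<open>The support of \<open>f\<close> may have infinite intensity, so simple functions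
  \<open>g n\<close> increase to \<open>f\<close>, and the limits in \<open>n\<close> and in the
  number \<open>m\<close> of factors must be interchanged. Monotonicity does this. From above,
  \<open>a m \<le> b n m\<close> for every \<open>n\<close>. From below, \<open>b n\<close>
  decreases to its limit, so \<open>b n m\<close> is at least \<open>exp (- I)\<close> for all
  \<open>n\<close> and \<open>m\<close>, and this bound survives the passage from
  \<open>b n m\<close> to \<open>a m\<close>.\<close>

lemma poisson_product:
  fixes f :: "real \<Rightarrow> real"
  assumes P: "poisson_point_process N \<Lambda> U" and N: "prob_space N" and sets [measurable_cong]: "sets \<Lambda> = sets borel"
    and int: "integrable \<Lambda> f"
    and f: "\<And>x. 0 \<le> f x" "\<And>x. f x \<le> 1"
  shows "(\<lambda>m. LINT \<omega>|N. (\<Prod>i<m. 1 - f (U i \<omega>))) \<longlonglongrightarrow> exp (- (LINT x|\<Lambda>. f x))"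
proof -
  interpret N: prob_space N by fact
  have space: "space \<Lambda> = UNIV" using sets_eq_imp_space_eq[OF sets] by simp
  have [measurable]: "U i \<in> borel_measurable N" for i
    using P by (simp add: poisson_point_process_def stochastic_process_def)
  have fm: "f \<in> borel_measurable \<Lambda>" using int by auto
  then have [measurable]: "f \<in> borel_measurable borel" by measurable
  obtain s where s: "\<And>i. simple_function \<Lambda> (s i)" "incseq s" "\<And>i x. s i x < top" "\<And>x. (SUP i. s i x) = ennreal (f x)"
    using borel_measurable_implies_simple_function_sequence'[of "\<lambda>x. ennreal (f x)" \<Lambda>] fm by auto
  define g where "g n x = enn2real (s n x)" for n x
  have sg: "s n x = ennreal (g n x)" for n x using s(3)[of n x] by (simp add: g_def)
  have g_le: "g n x \<le> f x" for n x
  proof -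
    have "s n x \<le> ennreal (f x)" using s(4)[of x] by (metis SUP_upper UNIV_I)
    then show ?thesis using f by (simp add: sg)
  qed
  have g0: "0 \<le> g n x" for n x by (simp add: g_def)
  have g1: "g n x \<le> 1" for n x using g_le[of n x] f(2)[of x] by linarith
  have g_lim: "(\<lambda>n. g n x) \<longlonglongrightarrow> f x" for x
  proof -
    have "incseq (\<lambda>n. s n x)" using s(2) by (auto simp: incseq_def le_fun_def)
    then have "(\<lambda>n. s n x) \<longlonglongrightarrow> ennreal (f x)" using LIMSEQ_SUP[of "\<lambda>n. s n x"] by (simp add: s(4))
    then show ?thesis using f g0 by (simp add: sg)
  qed
  have simple: "simple_function \<Lambda> (g n)" for n
    unfolding g_def by (intro simple_function_compose1[OF s(1), of enn2real])
  then have [measurable]: "g n \<in> borel_measurable borel" for n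
    using borel_measurable_simple_function[of \<Lambda> "g n"] by measurable
  have int_g: "integrable \<Lambda> (g n)" for n
    by (rule Bochner_Integration.integrable_bound[OF int]) (use g_le g0 f in \<open>auto intro!: AE_I2\<close>)
  define I where "I = (LINT x|\<Lambda>. f x)"
  define a where "a m = (LINT \<omega>|N. (\<Prod>i<m. 1 - f (U i \<omega>)))" for m
  define b where "b n m = (LINT \<omega>|N. (\<Prod>i<m. 1 - g n (U i \<omega>)))" for n m
  have b_lim: "b n \<longlonglongrightarrow> exp (- (LINT x|\<Lambda>. g n x))" for n
    unfolding b_def
  proof (rule poisson_product_simple[OF P N sets])
    show "finite (range (g n))" using simple[of n] by (simp add: simple_function_def space)
    have "(\<integral>\<^sup>+x. s n x \<partial>\<Lambda>) < \<infinity>"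
      using int_g[of n] g0 by (simp add: sg integrable_iff_bounded)
    then have "emeasure \<Lambda> {x\<in>space \<Lambda>. s n x \<noteq> 0} \<noteq> \<infinity>"
      by (intro simple_function_finite_support s(1)) auto
    then show "emeasure \<Lambda> {x. g n x \<noteq> 0} < \<infinity>"
      using g0 by (simp add: space sg less_top ennreal_eq_0_iff order_antisym_conv)
  qed (use g0 g1 in auto)
  have prod_bound: "0 \<le> (\<Prod>i<m. 1 - h (z i))" "(\<Prod>i<m. 1 - h (z i)) \<le> 1"
    if "\<And>x. 0 \<le> h x" "\<And>x. h x \<le> 1" for h :: "real \<Rightarrow> real" and z :: "nat \<Rightarrow> real" and m
    using that by (auto intro!: prod_nonneg prod_le_1)
  have prod_int: "integrable N (\<lambda>\<omega>. \<Prod>i<m. 1 - h (U i \<omega>))"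
    if "\<And>x. 0 \<le> h x" "\<And>x. h x \<le> 1" and [measurable]: "h \<in> borel_measurable borel" for h :: "real \<Rightarrow> real" and m
    using prod_bound[of h] that by (intro N.integrable_const_bound[of _ 1]) auto
  have dec: "decseq (b n)" for n
    unfolding b_def decseq_Suc_iff
  proof
    fix m
    show "(LINT \<omega>|N. (\<Prod>i<Suc m. 1 - g n (U i \<omega>))) \<le> (LINT \<omega>|N. (\<Prod>i<m. 1 - g n (U i \<omega>)))"
      by (intro integral_mono prod_int) (auto simp: g0 g1 intro!: mult_left_le prod_nonneg)
  qed
  have ab: "a m \<le> b n m" for m n
    unfolding a_def b_def
    by (intro integral_mono prod_int prod_mono) (auto simp: f g0 g1 g_le)
  have b_n: "(\<lambda>n. b n m) \<longlonglongrightarrow> a m" for m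
    unfolding a_def b_def
  proof (rule integral_dominated_convergence[where w="\<lambda>_. 1"])
    show "AE \<omega> in N. (\<lambda>n. \<Prod>i<m. 1 - g n (U i \<omega>)) \<longlonglongrightarrow> (\<Prod>i<m. 1 - f (U i \<omega>))"
      by (intro AE_I2 tendsto_intros g_lim)
    show "AE \<omega> in N. norm (\<Prod>i<m. 1 - g n (U i \<omega>)) \<le> 1" for n
      using prod_bound[of "g n"] g0 g1 by (auto intro!: AE_I2)
  qed auto
  have I_lim: "(\<lambda>n. exp (- (LINT x|\<Lambda>. g n x))) \<longlonglongrightarrow> exp (- I)"
    unfolding I_def
    by (intro tendsto_intros integral_dominated_convergence[where w=f])
       (use fm simple g_le g0 f g_lim int in \<open>auto intro!: AE_I2 borel_measurable_simple_function\<close>)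
  have lower: "exp (- I) \<le> a m" for m
  proof (rule LIMSEQ_le_const[OF b_n])
    have "exp (- I) \<le> b n m" for n
    proof -
      have "(LINT x|\<Lambda>. g n x) \<le> I" unfolding I_def by (intro integral_mono int_g int g_le)
      then have "exp (- I) \<le> exp (- (LINT x|\<Lambda>. g n x))" by simp
      also have "\<dots> \<le> b n m" by (rule decseq_ge[OF dec b_lim])
      finally show ?thesis .
    qed
    then show "\<exists>n. \<forall>k\<ge>n. exp (- I) \<le> b k m" by blast
  qed
  have "a \<longlonglongrightarrow> exp (- I)"
  proof (rule order_tendstoI)
    fix y assume "y < exp (- I)"
    then show "\<forall>\<^sub>F m in sequentially. y < a m" 
      by (intro always_eventually allI) (rule order_less_le_trans[OF _ lower])
  next
    fix y assume "exp (- I) < y"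
    then obtain n where "exp (- (LINT x|\<Lambda>. g n x)) < y"
      using order_tendstoD(2)[OF I_lim] by (auto simp: eventually_sequentially)
    then have "\<forall>\<^sub>F m in sequentially. b n m < y" by (rule order_tendstoD(2)[OF b_lim])
    then show "\<forall>\<^sub>F m in sequentially. a m < y"
      by eventually_elim (use ab in \<open>auto intro: order_le_less_trans\<close>)
  qed
  then show ?thesis unfolding a_def I_def .
qed

section \<open>Distribution functions of the Brown--Resnick supremum\<close>

text \<open>Here the points are frozen at deterministic values \<open>u i\<close>; this is the inner
  integral once independence from the Poisson points has been used.\<close>

lemma independent_copies_events:
  fixes X :: "nat \<Rightarrow> 't \<Rightarrow> 'b \<Rightarrow> real"
  assumes N: "prob_space N" and M: "stochastic_process M \<xi>"
    and copies: "independent_copies M \<xi> N X" and J: "finite J"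
  shows "measure N {\<omega> \<in> space N. \<forall>i<m. \<forall>j\<in>J. u i + X i (\<tau> j) \<omega> \<le> y j} =
    (\<Prod>i<m. 1 - measure M {\<omega> \<in> space M. \<exists>j\<in>J. y j < u i + \<xi> (\<tau> j) \<omega>})"
\<comment> \<open>The case is separate because an intersection over no indices is
  \<open>UNIV\<close> rather than \<open>space N\<close>.\<close>
proof (cases "m = 0")
  case True
  then show ?thesis using prob_space.prob_space[OF N] by simp
next
  case False
  interpret N: prob_space N by fact
  interpret M: prob_space M using M by (simp add: stochastic_process_def)
  have [measurable]: "\<xi> t \<in> borel_measurable M" for t using M by (simp add: stochastic_process_def)
  have X [measurable]: "X i t \<in> borel_measurable N" for i t
    using copies by (auto simp: independent_copies_def stochastic_process_def)
  define B where "B i = {x \<in> space (PiM UNIV (\<lambda>_. borel)). \<forall>j\<in>J. u i + x (\<tau> j) \<le> y j}" for i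
  have B [measurable]: "B i \<in> sets (PiM UNIV (\<lambda>_. borel))" for i
    unfolding B_def using J by measurable
  have ind: "N.indep_vars (\<lambda>_. PiM UNIV (\<lambda>_. borel)) (\<lambda>i \<omega> t. X i t \<omega>) {..<m}"
    using copies by (auto simp: independent_copies_def intro: N.indep_vars_subset)
  have "N.prob {\<omega> \<in> space N. \<forall>i<m. \<forall>j\<in>J. u i + X i (\<tau> j) \<omega> \<le> y j} =
      N.prob (\<Inter>i\<in>{..<m}. (\<lambda>\<omega> t. X i t \<omega>) -` B i \<inter> space N)"
    using False by (intro arg_cong[where f="measure N"]) (auto simp: B_def space_PiM)
  also have "\<dots> = (\<Prod>i<m. N.prob ((\<lambda>\<omega> t. X i t \<omega>) -` B i \<inter> space N))"
    using False by (intro N.indep_varsD_finite[OF ind]) auto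
  also have "\<dots> = (\<Prod>i<m. 1 - measure M {\<omega> \<in> space M. \<exists>j\<in>J. y j < u i + \<xi> (\<tau> j) \<omega>})"
  proof (intro prod.cong refl)
    fix i
    have mX: "(\<lambda>\<omega> t. X i t \<omega>) \<in> measurable N (PiM UNIV (\<lambda>_. borel))" by (rule measurable_PiM_single') auto
    have mxi: "(\<lambda>\<omega> t. \<xi> t \<omega>) \<in> measurable M (PiM UNIV (\<lambda>_. borel))" by (rule measurable_PiM_single') auto
    have "N.prob ((\<lambda>\<omega> t. X i t \<omega>) -` B i \<inter> space N) = measure (process_law N (X i)) (B i)"
      unfolding process_law_def by (rule measure_distr[OF mX B, symmetric])
    also have "\<dots> = measure (process_law M \<xi>) (B i)"
      using copies by (simp add: independent_copies_def)
    also have "\<dots> = M.prob ((\<lambda>\<omega> t. \<xi> t \<omega>) -` B i \<inter> space M)"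
      unfolding process_law_def by (rule measure_distr[OF mxi B])
    also have "(\<lambda>\<omega> t. \<xi> t \<omega>) -` B i \<inter> space M = space M - {\<omega> \<in> space M. \<exists>j\<in>J. y j < u i + \<xi> (\<tau> j) \<omega>}"
      by (auto simp: B_def space_PiM not_le)
    also have "M.prob \<dots> = 1 - M.prob {\<omega> \<in> space M. \<exists>j\<in>J. y j < u i + \<xi> (\<tau> j) \<omega>}"
      using J by (intro M.prob_compl) measurable
    finally show "N.prob ((\<lambda>\<omega> t. X i t \<omega>) -` B i \<inter> space N) = \<dots>" .
  qed
  finally show ?thesis .
qed

text \<open>Independence makes the joint law of copies and points a product measure. Integrating out
  the copies first, with the points fixed, leaves one factor \<open>1 - G (U i \<omega>)\<close> for
  each point.\<close>

lemma brown_resnick_realisation_finite_cdf: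
  fixes X :: "nat \<Rightarrow> 't \<Rightarrow> 'b \<Rightarrow> real"
  assumes R: "brown_resnick_realisation M \<xi> N X U" and M: "stochastic_process M \<xi>" and J: "finite J"
    and G: "G = (\<lambda>u. measure M {\<omega> \<in> space M. \<exists>j\<in>J. y j < u + \<xi> (\<tau> j) \<omega>})"
    and [measurable]: "G \<in> borel_measurable borel"
  shows "measure N {\<omega> \<in> space N. \<forall>i<m. \<forall>j\<in>J. U i \<omega> + X i (\<tau> j) \<omega> \<le> y j} =
    (LINT \<omega>|N. (\<Prod>i<m. 1 - G (U i \<omega>)))"
proof -
  interpret M: prob_space M using M by (simp add: stochastic_process_def)
  interpret N: prob_space N using R by (simp add: brown_resnick_realisation_def)
  have copies: "independent_copies M \<xi> N X" using R by (simp add: brown_resnick_realisation_def)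
  have [measurable]: "X i t \<in> borel_measurable N" for i t
    using copies by (auto simp: independent_copies_def stochastic_process_def)
  have [measurable]: "U i \<in> borel_measurable N" for i
    using R by (simp add: brown_resnick_realisation_def poisson_point_process_def stochastic_process_def)
  define SX :: "(nat \<Rightarrow> 't \<Rightarrow> real) measure" where "SX = PiM UNIV (\<lambda>_. PiM UNIV (\<lambda>_. borel))"
  \<comment> \<open>\<open>indep_var\<close> needs both variables to have the same type, hence the dummy argument \<open>t\<close> of the points.\<close>
  define V where "V = (\<lambda>\<omega> i (t :: 't). U i \<omega>)"
  have mX [measurable]: "(\<lambda>\<omega> i t. X i t \<omega>) \<in> measurable N SX"
    unfolding SX_def by (intro measurable_PiM_single') (auto simp: space_PiM)
  have mV [measurable]: "V \<in> measurable N SX"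
    unfolding SX_def V_def by (intro measurable_PiM_single') (auto simp: space_PiM)
  have "N.indep_set (sigma_sets (space N) {(\<lambda>\<omega> i t. X i t \<omega>) -` A \<inter> space N | A. A \<in> sets SX})
      (sigma_sets (space N) {V -` A \<inter> space N | A. A \<in> sets SX})"
  proof -
    \<comment> \<open>\<open>V\<close> is a measurable function of the point sequence, so it
      generates no more events than the sequence does, and the assumed independence carries
      over.\<close>
    have lift: "(\<lambda>x i (t :: 't). x i) \<in> measurable (PiM UNIV (\<lambda>_. borel)) SX"
      unfolding SX_def by (intro measurable_PiM_single') (auto simp: space_PiM)
    have "{V -` A \<inter> space N | A. A \<in> sets SX} \<subseteq>
        {(\<lambda>\<omega> i. U i \<omega>) -` A \<inter> space N | A. A \<in> sets (PiM UNIV (\<lambda>_. borel))}"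
    proof clarify
      fix A assume "A \<in> sets SX"
      from measurable_sets[OF lift this]
      show "\<exists>B. V -` A \<inter> space N = (\<lambda>\<omega> i. U i \<omega>) -` B \<inter> space N \<and> B \<in> sets (PiM UNIV (\<lambda>_. borel))"
        by (intro exI conjI) (auto simp: V_def space_PiM)
    qed
    then have "sigma_sets (space N) {V -` A \<inter> space N | A. A \<in> sets SX} \<subseteq>
        sigma_sets (space N) {(\<lambda>\<omega> i. U i \<omega>) -` A \<inter> space N | A. A \<in> sets (PiM UNIV (\<lambda>_. borel))}"
      by (rule sigma_sets_subseteq)
    with R show ?thesis
      unfolding N.indep_sets2_eq brown_resnick_realisation_def sets_vimage_algebra SX_def by blast
  qed
  then have "N.indep_var SX (\<lambda>\<omega> i t. X i t \<omega>) SX V"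
    using mX mV by (simp add: N.indep_var_eq)
  then have law: "distr N SX (\<lambda>\<omega> i t. X i t \<omega>) \<Otimes>\<^sub>M distr N SX V =
      distr N (SX \<Otimes>\<^sub>M SX) (\<lambda>\<omega>. (\<lambda>i t. X i t \<omega>, V \<omega>))"
    by (simp add: N.indep_var_distribution_eq)
  have [measurable]: "(\<lambda>x. x i t) \<in> borel_measurable SX" for i t
  proof -
    have "(\<lambda>x. x i) \<in> measurable SX (PiM UNIV (\<lambda>_. borel))"
      unfolding SX_def by (rule measurable_component_singleton) simp
    then show ?thesis
      by (rule measurable_compose) (rule measurable_component_singleton, simp)
  qed
  \<comment> \<open>\<open>V\<close> is constant in its dummy argument, so evaluation at
    \<open>undefined\<close> recovers the point.\<close>
  define K where "K = {p \<in> space (SX \<Otimes>\<^sub>M SX). \<forall>i<m. \<forall>j\<in>J. snd p i undefined + fst p i (\<tau> j) \<le> y j}"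
  have K_sets [measurable]: "K \<in> sets (SX \<Otimes>\<^sub>M SX)"
    unfolding K_def using J by measurable
  have K_iff: "((\<lambda>i t. X i t \<omega>), V \<omega>') \<in> K \<longleftrightarrow> (\<forall>i<m. \<forall>j\<in>J. U i \<omega>' + X i (\<tau> j) \<omega> \<le> y j)" for \<omega> \<omega>'
    by (simp add: K_def space_pair_measure SX_def space_PiM V_def)
  interpret PX: prob_space "distr N SX (\<lambda>\<omega> i t. X i t \<omega>)" by (rule N.prob_space_distr[OF mX])
  interpret PU: prob_space "distr N SX V" by (rule N.prob_space_distr[OF mV])
  interpret XU: pair_sigma_finite "distr N SX (\<lambda>\<omega> i t. X i t \<omega>)" "distr N SX V" ..
  have G01: "0 \<le> G u" "G u \<le> 1" for u by (auto simp: G)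
  have "emeasure N {\<omega> \<in> space N. \<forall>i<m. \<forall>j\<in>J. U i \<omega> + X i (\<tau> j) \<omega> \<le> y j} =
      (\<integral>\<^sup>+\<omega>. indicator K (\<lambda>i t. X i t \<omega>, V \<omega>) \<partial>N)"
  proof -
    have "(\<integral>\<^sup>+\<omega>. indicator K (\<lambda>i t. X i t \<omega>, V \<omega>) \<partial>N) =
        (\<integral>\<^sup>+\<omega>. indicator {\<omega> \<in> space N. \<forall>i<m. \<forall>j\<in>J. U i \<omega> + X i (\<tau> j) \<omega> \<le> y j} \<omega> \<partial>N)"
      by (intro nn_integral_cong) (auto simp: K_iff split: split_indicator)
    also have "\<dots> = emeasure N {\<omega> \<in> space N. \<forall>i<m. \<forall>j\<in>J. U i \<omega> + X i (\<tau> j) \<omega> \<le> y j}"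
      using J by (intro nn_integral_indicator) measurable
    finally show ?thesis ..
  qed
  also have "\<dots> = (\<integral>\<^sup>+p. indicator K p \<partial>(distr N SX (\<lambda>\<omega> i t. X i t \<omega>) \<Otimes>\<^sub>M distr N SX V))"
    unfolding law by (subst nn_integral_distr) auto
  also have "\<dots> = (\<integral>\<^sup>+u. \<integral>\<^sup>+x. indicator K (x, u) \<partial>distr N SX (\<lambda>\<omega> i t. X i t \<omega>) \<partial>distr N SX V)"
    by (subst XU.nn_integral_snd) auto
  also have "\<dots> = (\<integral>\<^sup>+\<omega>'. \<integral>\<^sup>+\<omega>. indicator K (\<lambda>i t. X i t \<omega>, V \<omega>') \<partial>N \<partial>N)"
  proof -
    have "(\<lambda>x. indicator K (x, u) :: ennreal) \<in> borel_measurable SX" for u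
    proof -
      have u: "u \<in> space SX" by (simp add: SX_def space_PiM)
      show ?thesis
        by (rule measurable_compose[OF measurable_Pair2'[OF u] borel_measurable_indicator[OF K_sets]])
    qed
    then show ?thesis by (simp add: nn_integral_distr)
  qed
  also have "\<dots> = (\<integral>\<^sup>+\<omega>'. ennreal (\<Prod>i<m. 1 - G (U i \<omega>')) \<partial>N)"
  proof (rule nn_integral_cong)
    fix \<omega>'
    have "(\<integral>\<^sup>+\<omega>. indicator K (\<lambda>i t. X i t \<omega>, V \<omega>') \<partial>N) =
        (\<integral>\<^sup>+\<omega>. indicator {\<omega> \<in> space N. \<forall>i<m. \<forall>j\<in>J. U i \<omega>' + X i (\<tau> j) \<omega> \<le> y j} \<omega> \<partial>N)"
      by (intro nn_integral_cong) (auto simp: K_iff split: split_indicator)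
    also have "\<dots> = emeasure N {\<omega> \<in> space N. \<forall>i<m. \<forall>j\<in>J. U i \<omega>' + X i (\<tau> j) \<omega> \<le> y j}"
      using J by (intro nn_integral_indicator) measurable
    finally have "(\<integral>\<^sup>+\<omega>. indicator K (\<lambda>i t. X i t \<omega>, V \<omega>') \<partial>N) = \<dots>" .
    then show "(\<integral>\<^sup>+\<omega>. indicator K (\<lambda>i t. X i t \<omega>, V \<omega>') \<partial>N) = ennreal (\<Prod>i<m. 1 - G (U i \<omega>'))"
      using independent_copies_events[OF N.prob_space_axioms M copies J, where u="\<lambda>i. U i \<omega>'"]
      by (simp add: N.emeasure_eq_measure G)
  qed
  also have "\<dots> = ennreal (LINT \<omega>|N. (\<Prod>i<m. 1 - G (U i \<omega>)))"
    using G01 by (intro nn_integral_eq_integral N.integrable_const_bound[of _ 1] AE_I2)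
      (auto simp: abs_prod intro!: prod_nonneg prod_le_1)
  finally show ?thesis
    using G01 by (simp add: N.emeasure_eq_measure prod_nonneg)
qed

text \<open>A supremum stays below a level exactly when all its terms do. The event is therefore the
  decreasing limit of the events for the first \<open>m\<close> points, and
  \<open>poisson_product\<close> supplies the limit of their probabilities.\<close>

lemma brown_resnick_realisation_cdf:
  fixes X :: "nat \<Rightarrow> 't \<Rightarrow> 'b \<Rightarrow> real"
  assumes R: "brown_resnick_realisation M \<xi> N X U" and M: "stochastic_process M \<xi>" and J: "finite J"
    and G: "G = (\<lambda>u. measure M {\<omega> \<in> space M. \<exists>j\<in>J. y j < u + \<xi> (\<tau> j) \<omega>})"
    and int: "integrable exp_intensity G"
  shows "measure N {\<omega> \<in> space N. \<forall>j\<in>J. brown_resnick_sup X U (\<tau> j) \<omega> \<le> ereal (y j)} =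
    exp (- (LINT u|exp_intensity. G u))"
proof -
  interpret M: prob_space M using M by (simp add: stochastic_process_def)
  interpret N: prob_space N using R by (simp add: brown_resnick_realisation_def)
  have P: "poisson_point_process N exp_intensity U" using R by (simp add: brown_resnick_realisation_def)
  have [measurable]: "X i t \<in> borel_measurable N" for i t
    using R by (auto simp: brown_resnick_realisation_def independent_copies_def stochastic_process_def)
  have [measurable]: "U i \<in> borel_measurable N" for i
    using P by (simp add: poisson_point_process_def stochastic_process_def)
  have sets [measurable_cong]: "sets exp_intensity = sets borel" by (simp add: exp_intensity_def)
  have "G \<in> borel_measurable exp_intensity" using int by auto
  then have Gm: "G \<in> borel_measurable borel" by measurable
  define E where "E m = {\<omega> \<in> space N. \<forall>i<m. \<forall>j\<in>J. U i \<omega> + X i (\<tau> j) \<omega> \<le> y j}" for m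
  have "(\<lambda>m. measure N (E m)) \<longlonglongrightarrow> measure N (\<Inter>m. E m)"
  proof (rule N.finite_Lim_measure_decseq)
    show "range E \<subseteq> N.events" unfolding E_def using J by (intro image_subsetI) measurable
    show "decseq E" by (auto simp: E_def decseq_def)
  qed
  moreover have "(\<lambda>m. measure N (E m)) \<longlonglongrightarrow> exp (- (LINT u|exp_intensity. G u))"
    unfolding E_def brown_resnick_realisation_finite_cdf[OF R M J G Gm]
    by (rule poisson_product[OF P N.prob_space_axioms sets int]) (auto simp: G)
  ultimately have "measure N (\<Inter>m. E m) = exp (- (LINT u|exp_intensity. G u))"
    by (rule LIMSEQ_unique)
  also have "(\<Inter>m. E m) = {\<omega> \<in> space N. \<forall>j\<in>J. brown_resnick_sup X U (\<tau> j) \<omega> \<le> ereal (y j)}"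
    by (auto simp: E_def brown_resnick_sup_def SUP_le_iff)
  finally show ?thesis .
qed

section \<open>Exceedance intensities and their dependence on increments\<close>

lemma emeasure_exp_intensity_finite: "emeasure exp_intensity {a<..} < \<infinity>"
proof -
  have "emeasure exp_intensity {a<..} \<le> emeasure exp_intensity {a..}"
    by (intro emeasure_mono) (auto simp: exp_intensity_def)
  also have "\<dots> = (\<integral>\<^sup>+x. ennreal (exp (- x)) * indicator {a..} x \<partial>lborel)"
    by (simp add: exp_intensity_def emeasure_density)
  also have "\<dots> = ennreal (0 - (- exp (- a)))"
  proof (rule nn_integral_FTC_atLeast)
    show "((\<lambda>x::real. - exp (- x)) \<longlongrightarrow> 0) at_top" by real_asymp
  qed (auto intro!: derivative_eq_intros)
  finally show ?thesis by (simp add: order_le_less_trans)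
qed

context centred_gaussian_process
begin

abbreviation second_moment :: "('a \<Rightarrow> real) \<Rightarrow> real" where
  "second_moment Y \<equiv> expectation (\<lambda>\<omega>. (Y \<omega>)\<^sup>2)"

lemma exceedance_eq_nn_integral:
  fixes Y :: "'j \<Rightarrow> 'a \<Rightarrow> real"
  assumes J: "finite J" and [measurable]: "\<And>j. j \<in> J \<Longrightarrow> Y j \<in> borel_measurable M"
  shows "emeasure M {\<omega> \<in> space M. \<exists>j\<in>J. y j < u + Y j \<omega>} =
    (\<integral>\<^sup>+\<omega>. (if \<exists>j\<in>J. y j < u + Y j \<omega> then 1 else 0) \<partial>M)"
proof -
  have "(\<integral>\<^sup>+\<omega>. (if \<exists>j\<in>J. y j < u + Y j \<omega> then 1 else 0) \<partial>M) =
      (\<integral>\<^sup>+\<omega>. indicator {\<omega> \<in> space M. \<exists>j\<in>J. y j < u + Y j \<omega>} \<omega> \<partial>M)"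
    by (intro nn_integral_cong) (auto split: split_indicator)
  also have "\<dots> = emeasure M {\<omega> \<in> space M. \<exists>j\<in>J. y j < u + Y j \<omega>}"
    using J by (intro nn_integral_indicator) measurable
  finally show ?thesis ..
qed

text \<open>The left-hand side does not mention \<open>s\<close>, so all reference points give the
  same intensity. This freedom is used twice: to compare shifted with unshifted points, and to prove
  finiteness by letting a point be its own reference.\<close>

lemma exceedance_intensity_increments:
  fixes \<tau> :: "'j \<Rightarrow> 't"
  assumes J: "finite J"
  shows "(\<integral>\<^sup>+u. emeasure M {\<omega> \<in> space M. \<exists>j\<in>J. y j < u + (W (\<tau> j) \<omega> - second_moment (W (\<tau> j)) / 2)} \<partial>exp_intensity) =
    (\<integral>\<^sup>+u. emeasure M {\<omega> \<in> space M. \<exists>j\<in>J. y j < u + (W (\<tau> j) \<omega> - W s \<omega> - second_moment (\<lambda>\<omega>. W (\<tau> j) \<omega> - W s \<omega>) / 2)} \<partial>exp_intensity)"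
proof -
  define v where "v t = second_moment (W t)" for t
  define V where "V j \<omega> = W (\<tau> j) \<omega> - W s \<omega>" for j \<omega>
  define k :: "real \<Rightarrow> ('j \<Rightarrow> real) \<Rightarrow> ennreal" where "k u d = (if \<exists>j\<in>J. y j < u + d j then 1 else 0)" for u d
  have V: "V j \<in> gaussian_span" for j unfolding V_def[abs_def] by (intro span_diff span_W)
  note [measurable] = span_measurable[OF V]
  have prob_k: "emeasure M {\<omega> \<in> space M. \<exists>j\<in>J. y j < u + Y j \<omega>} = (\<integral>\<^sup>+\<omega>. k u (\<lambda>j. Y j \<omega>) \<partial>M)"
    if [measurable]: "\<And>j. Y j \<in> borel_measurable M" for Y u
    unfolding k_def by (rule exceedance_eq_nn_integral[OF J that])
  \<comment> \<open>With \<open>C\<close> the covariance of \<open>W (\<tau> j)\<close> and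
    \<open>W s\<close>, both corrections to \<open>V j\<close> equal
    \<open>C - v (\<tau> j) / 2 - v s / 2\<close>.\<close>
  have shift: "V j \<omega> + expectation (\<lambda>\<omega>. V j \<omega> * W s \<omega>) - v (\<tau> j) / 2 + v s / 2 = V j \<omega> - second_moment (V j) / 2" for j \<omega>
  proof -
    have i: "integrable M (\<lambda>\<omega>. W t \<omega> * W t' \<omega>)" "integrable M (\<lambda>\<omega>. (W t \<omega>)\<^sup>2)" for t t'
      by (intro span_mult_integrable span_square span_W)+
    have "expectation (\<lambda>\<omega>. V j \<omega> * W s \<omega>) = expectation (\<lambda>\<omega>. W (\<tau> j) \<omega> * W s \<omega> - (W s \<omega>)\<^sup>2)"
      by (simp add: V_def algebra_simps power2_eq_square)
    also have "\<dots> = expectation (\<lambda>\<omega>. W (\<tau> j) \<omega> * W s \<omega>) - v s"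
      using i by (simp add: v_def)
    finally have 1: "expectation (\<lambda>\<omega>. V j \<omega> * W s \<omega>) = \<dots>" .
    have "second_moment (V j) = expectation (\<lambda>\<omega>. (W (\<tau> j) \<omega>)\<^sup>2 + (W s \<omega>)\<^sup>2 - 2 * (W (\<tau> j) \<omega> * W s \<omega>))"
      by (simp add: V_def algebra_simps power2_eq_square)
    also have "\<dots> = v (\<tau> j) + v s - 2 * expectation (\<lambda>\<omega>. W (\<tau> j) \<omega> * W s \<omega>)"
      using i by (simp add: v_def)
    finally show ?thesis using 1 by (simp add: field_simps)
  qed
  interpret LM: pair_sigma_finite lborel M ..
  have "(\<integral>\<^sup>+u. emeasure M {\<omega> \<in> space M. \<exists>j\<in>J. y j < u + (W (\<tau> j) \<omega> - v (\<tau> j) / 2)} \<partial>exp_intensity) =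
      (\<integral>\<^sup>+u. ennreal (exp (- u)) * (\<integral>\<^sup>+\<omega>. k u (\<lambda>j. W (\<tau> j) \<omega> - v (\<tau> j) / 2) \<partial>M) \<partial>lborel)"
    unfolding exp_intensity_def using J
    by (subst prob_k, measurable, subst nn_integral_density) (auto simp: k_def)
  also have "\<dots> = (\<integral>\<^sup>+u. \<integral>\<^sup>+\<omega>. ennreal (exp (- u)) * k u (\<lambda>j. W (\<tau> j) \<omega> - v (\<tau> j) / 2) \<partial>M \<partial>lborel)"
    unfolding k_def using J by (subst nn_integral_cmult) auto
  \<comment> \<open>The coming substitution translates \<open>u\<close> by an amount depending on
    \<omega>, so \<open>u\<close> must be the inner variable. Afterwards the order is restored,
    because the Gaussian tilt acts on the integral over \<omega> for fixed \<open>u\<close>.\<close>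
  also have "\<dots> = (\<integral>\<^sup>+\<omega>. \<integral>\<^sup>+u. ennreal (exp (- u)) * k u (\<lambda>j. W (\<tau> j) \<omega> - v (\<tau> j) / 2) \<partial>lborel \<partial>M)"
    unfolding k_def using J by (subst LM.Fubini') auto
  also have "\<dots> = (\<integral>\<^sup>+\<omega>. \<integral>\<^sup>+u. ennreal (exp (- u)) * (ennreal (exp (W s \<omega> - v s / 2)) * k u (\<lambda>j. V j \<omega> - v (\<tau> j) / 2 + v s / 2)) \<partial>lborel \<partial>M)"
  proof (rule nn_integral_cong)
    fix \<omega>
    \<comment> \<open>Translation by \<open>?a\<close> multiplies \<open>exp (- u)\<close> by the
      tilting density at \<open>s\<close> and at the same time turns \<open>W (\<tau> j)\<close>
      into the increment \<open>V j\<close>.\<close>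
    let ?a = "- (W s \<omega> - v s / 2)"
    have "(\<integral>\<^sup>+u. ennreal (exp (- u)) * k u (\<lambda>j. W (\<tau> j) \<omega> - v (\<tau> j) / 2) \<partial>lborel) =
        (\<integral>\<^sup>+u. ennreal (exp (- (?a + u))) * k (?a + u) (\<lambda>j. W (\<tau> j) \<omega> - v (\<tau> j) / 2) \<partial>lborel)"
      unfolding k_def using J by (subst nn_integral_real_affine[where c=1 and t="?a"]) auto
    also have "\<dots> = (\<integral>\<^sup>+u. ennreal (exp (- u)) * (ennreal (exp (W s \<omega> - v s / 2)) * k u (\<lambda>j. V j \<omega> - v (\<tau> j) / 2 + v s / 2)) \<partial>lborel)"
    proof (rule nn_integral_cong)
      fix u
      have "exp (- (?a + u)) = exp (- u) * exp (W s \<omega> - v s / 2)" by (simp add: exp_add[symmetric])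
      moreover have "k (?a + u) (\<lambda>j. W (\<tau> j) \<omega> - v (\<tau> j) / 2) = k u (\<lambda>j. V j \<omega> - v (\<tau> j) / 2 + v s / 2)"
        by (simp add: k_def V_def algebra_simps)
      ultimately show "ennreal (exp (- (?a + u))) * k (?a + u) (\<lambda>j. W (\<tau> j) \<omega> - v (\<tau> j) / 2) =
          ennreal (exp (- u)) * (ennreal (exp (W s \<omega> - v s / 2)) * k u (\<lambda>j. V j \<omega> - v (\<tau> j) / 2 + v s / 2))"
        by (simp only: ennreal_mult' exp_ge_zero mult.assoc)
    qed
    finally show "(\<integral>\<^sup>+u. ennreal (exp (- u)) * k u (\<lambda>j. W (\<tau> j) \<omega> - v (\<tau> j) / 2) \<partial>lborel) = \<dots>" .
  qed
  also have "\<dots> = (\<integral>\<^sup>+u. \<integral>\<^sup>+\<omega>. ennreal (exp (- u)) * (ennreal (exp (W s \<omega> - v s / 2)) * k u (\<lambda>j. V j \<omega> - v (\<tau> j) / 2 + v s / 2)) \<partial>M \<partial>lborel)"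
    unfolding k_def using J by (subst LM.Fubini') auto
  also have "\<dots> = (\<integral>\<^sup>+u. ennreal (exp (- u)) * (\<integral>\<^sup>+\<omega>. ennreal (exp (W s \<omega> - v s / 2)) * k u (\<lambda>j. V j \<omega> - v (\<tau> j) / 2 + v s / 2) \<partial>M) \<partial>lborel)"
    unfolding k_def using J by (subst nn_integral_cmult) auto
  also have "\<dots> = (\<integral>\<^sup>+u. ennreal (exp (- u)) * (\<integral>\<^sup>+\<omega>. k u (\<lambda>j. V j \<omega> - second_moment (V j) / 2) \<partial>M) \<partial>lborel)"
  proof (rule nn_integral_cong, rule arg_cong2[where f="(*)", OF refl])
    fix u
    \<comment> \<open>The tilt is available for functions on the finite product over
      \<open>J\<close>. Since \<open>k\<close> inspects only coordinates in \<open>J\<close>,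
      restricting its argument does not change its value.\<close>
    define F where "F z = k u (\<lambda>j. z j - v (\<tau> j) / 2 + v s / 2)" for z
    have F: "F \<in> borel_measurable (PiM J (\<lambda>_. borel))"
      unfolding F_def[abs_def] k_def using J by measurable
    have cong: "F z = F z'" if "\<And>j. j \<in> J \<Longrightarrow> z j = z' j" for z z'
      using that by (auto simp: F_def k_def)
    have "(\<integral>\<^sup>+\<omega>. ennreal (exp (W s \<omega> - v s / 2)) * F (\<lambda>j. V j \<omega>) \<partial>M) =
        (\<integral>\<^sup>+\<omega>. ennreal (exp (W s \<omega> - v s / 2)) * F (\<lambda>j\<in>J. V j \<omega>) \<partial>M)"
      by (intro nn_integral_cong arg_cong2[where f="(*)"] refl cong) simp
    also have "\<dots> = (\<integral>\<^sup>+\<omega>. F (\<lambda>j\<in>J. V j \<omega> + expectation (\<lambda>\<omega>. V j \<omega> * W s \<omega>)) \<partial>M)"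
      unfolding v_def by (rule span_tilt[OF span_W V J F])
    also have "\<dots> = (\<integral>\<^sup>+\<omega>. k u (\<lambda>j. V j \<omega> - second_moment (V j) / 2) \<partial>M)"
    proof (rule nn_integral_cong)
      fix \<omega>
      have "F (\<lambda>j\<in>J. V j \<omega> + expectation (\<lambda>\<omega>. V j \<omega> * W s \<omega>)) = F (\<lambda>j. V j \<omega> + expectation (\<lambda>\<omega>. V j \<omega> * W s \<omega>))"
        by (rule cong) simp
      then show "F (\<lambda>j\<in>J. V j \<omega> + expectation (\<lambda>\<omega>. V j \<omega> * W s \<omega>)) = k u (\<lambda>j. V j \<omega> - second_moment (V j) / 2)"
        by (simp only: F_def shift)
    qed
    finally show "(\<integral>\<^sup>+\<omega>. ennreal (exp (W s \<omega> - v s / 2)) * k u (\<lambda>j. V j \<omega> - v (\<tau> j) / 2 + v s / 2) \<partial>M) = \<dots>"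
      by (simp add: F_def)
  qed
  also have "\<dots> = (\<integral>\<^sup>+u. emeasure M {\<omega> \<in> space M. \<exists>j\<in>J. y j < u + (V j \<omega> - second_moment (V j) / 2)} \<partial>exp_intensity)"
    unfolding exp_intensity_def using J
    by (subst prob_k, measurable, subst nn_integral_density) (auto simp: k_def)
  finally show ?thesis unfolding v_def V_def .
qed

lemma exceedance_measurable:
  fixes Y :: "'j \<Rightarrow> 'a \<Rightarrow> real"
  assumes J: "finite J" and [measurable]: "\<And>j. j \<in> J \<Longrightarrow> Y j \<in> borel_measurable M"
  shows "(\<lambda>u. emeasure M {\<omega> \<in> space M. \<exists>j\<in>J. y j < u + Y j \<omega>}) \<in> borel_measurable borel"
  unfolding exceedance_eq_nn_integral[OF assms] using J by measurable

text \<open>By the union bound one point suffices. Taken as its own reference it has increment zero,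
  and the intensity becomes the mass of a half-line. The quantifier over \<open>{j}\<close> keeps
  the single-point case an instance of the general formula.\<close>

lemma exceedance_intensity_finite:
  fixes \<tau> :: "'j \<Rightarrow> 't"
  assumes J: "finite J"
  shows "(\<integral>\<^sup>+u. emeasure M {\<omega> \<in> space M. \<exists>j\<in>J. y j < u + (W (\<tau> j) \<omega> - second_moment (W (\<tau> j)) / 2)} \<partial>exp_intensity) < \<infinity>"
proof -
  have sets [measurable_cong]: "sets exp_intensity = sets borel" by (simp add: exp_intensity_def)
  let ?\<xi> = "\<lambda>j \<omega>. W (\<tau> j) \<omega> - second_moment (W (\<tau> j)) / 2"
  have single: "(\<integral>\<^sup>+u. emeasure M {\<omega> \<in> space M. \<exists>i\<in>{j}. y i < u + ?\<xi> i \<omega>} \<partial>exp_intensity) < \<infinity>" for j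
  proof -
    have "(\<integral>\<^sup>+u. emeasure M {\<omega> \<in> space M. \<exists>i\<in>{j}. y i < u + ?\<xi> i \<omega>} \<partial>exp_intensity) =
        (\<integral>\<^sup>+u. emeasure M {\<omega> \<in> space M. y j < u} \<partial>exp_intensity)"
      by (subst exceedance_intensity_increments[where s="\<tau> j"]) auto
    also have "\<dots> = (\<integral>\<^sup>+u. indicator {y j<..} u \<partial>exp_intensity)"
      by (intro nn_integral_cong) (auto simp: emeasure_space_1 split: split_indicator)
    also have "\<dots> = emeasure exp_intensity {y j<..}"
      by (simp add: sets)
    also have "\<dots> < \<infinity>" by (rule emeasure_exp_intensity_finite)
    finally show ?thesis .
  qed
  have "(\<integral>\<^sup>+u. emeasure M {\<omega> \<in> space M. \<exists>j\<in>J. y j < u + ?\<xi> j \<omega>} \<partial>exp_intensity) \<le>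
      (\<integral>\<^sup>+u. (\<Sum>j\<in>J. emeasure M {\<omega> \<in> space M. \<exists>i\<in>{j}. y i < u + ?\<xi> i \<omega>}) \<partial>exp_intensity)"
  proof (intro nn_integral_mono)
    fix u
    have "{\<omega> \<in> space M. \<exists>j\<in>J. y j < u + ?\<xi> j \<omega>} = (\<Union>j\<in>J. {\<omega> \<in> space M. \<exists>i\<in>{j}. y i < u + ?\<xi> i \<omega>})"
      by auto
    then show "emeasure M {\<omega> \<in> space M. \<exists>j\<in>J. y j < u + ?\<xi> j \<omega>} \<le>
        (\<Sum>j\<in>J. emeasure M {\<omega> \<in> space M. \<exists>i\<in>{j}. y i < u + ?\<xi> i \<omega>})"
      by (simp only:) (intro emeasure_subadditive_finite J, auto)
  qed
  also have "\<dots> = (\<Sum>j\<in>J. \<integral>\<^sup>+u. emeasure M {\<omega> \<in> space M. \<exists>i\<in>{j}. y i < u + ?\<xi> i \<omega>} \<partial>exp_intensity)"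
    by (intro nn_integral_sum) (unfold measurable_cong_sets[OF sets refl], intro exceedance_measurable, auto)
  also have "\<dots> < \<infinity>" using J single by (simp add: ennreal_sum_less_top)
  finally show ?thesis .
qed

end

section \<open>Translation invariance of the supremum process\<close>

theorem theorem10:
  fixes M :: "'a measure" and W :: "real ^ 'd \<Rightarrow> 'a \<Rightarrow> real"
  assumes "gaussian_process M W"
    and "zero_mean M W"
    and "stationary_increments M W"
  shows "brown_resnick_stationary TYPE('b) M
    (\<lambda>t \<omega>. W t \<omega> - prob_space.variance M (W t) / 2)"
proof -
  interpret centred_gaussian_process M W by standard (use assms in auto)
  have sets [measurable_cong]: "sets exp_intensity = sets borel" by (simp add: exp_intensity_def)
  define \<xi> where "\<xi> t \<omega> = W t \<omega> - second_moment (W t) / 2" for t \<omega>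
  have \<xi>_eq: "(\<lambda>t \<omega>. W t \<omega> - prob_space.variance M (W t) / 2) = \<xi>"
    by (simp add: \<xi>_def[abs_def] span_expectation[OF span_W])
  have [measurable]: "\<xi> t \<in> borel_measurable M" for t unfolding \<xi>_def[abs_def] by measurable
  have M\<xi>: "stochastic_process M \<xi>"
    by (simp add: stochastic_process_def prob_space_axioms)
  \<comment> \<open>The tilt with no components and constant integrand 1 says that
    \<open>exp (\<xi> t)\<close> has mean 1.\<close>
  have exp_int: "integrable M (\<lambda>\<omega>. exp (\<xi> t \<omega>))" for t
  proof (rule integrableI_nonneg)
    have "(\<integral>\<^sup>+\<omega>. ennreal (exp (\<xi> t \<omega>)) \<partial>M) = (\<integral>\<^sup>+\<omega>. 1 \<partial>M)"
      using span_tilt[OF span_W, of "{}" "\<lambda>_. W t" "\<lambda>_. 1" t] by (simp add: \<xi>_def)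
    then show "(\<integral>\<^sup>+\<omega>. ennreal (exp (\<xi> t \<omega>)) \<partial>M) < \<infinity>" by (simp add: emeasure_space_1)
  qed auto
  \<comment> \<open>The shift \<open>h\<close> sits inside \<xi> while the levels stay indexed by
    \<open>J\<close>, so shifted and unshifted processes are tested against the same
    thresholds.\<close>
  define G where "G h J y u = measure M {\<omega> \<in> space M. \<exists>t\<in>J. y t < u + \<xi> (t + h) \<omega>}" for h J y u
  have G_nn: "(\<integral>\<^sup>+u. ennreal (G h J y u) \<partial>exp_intensity) =
      (\<integral>\<^sup>+u. emeasure M {\<omega> \<in> space M. \<exists>t\<in>J. y t < u + (W (t + h) \<omega> - second_moment (W (t + h)) / 2)} \<partial>exp_intensity)" for h J y
    by (simp add: G_def emeasure_eq_measure \<xi>_def)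
  have G_meas: "G h J y \<in> borel_measurable exp_intensity" if "finite J" for h J y
  proof -
    have "(\<lambda>u. enn2real (emeasure M {\<omega> \<in> space M. \<exists>t\<in>J. y t < u + \<xi> (t + h) \<omega>})) \<in> borel_measurable borel"
      by (intro measurable_compose[OF exceedance_measurable] that) auto
    then show ?thesis
      unfolding measurable_cong_sets[OF sets refl] G_def[abs_def] by (simp add: measure_def)
  qed
  have G_int: "integrable exp_intensity (G h J y)" if "finite J" for h J y
    using exceedance_intensity_finite[OF that, of y "\<lambda>t. t + h"] G_meas[OF that]
    by (intro integrableI_nonneg) (auto simp: G_nn, auto simp: G_def)
  define \<Delta> where "\<Delta> h = (\<lambda>t \<omega>. W (t + h) \<omega> - W h \<omega>)" for h
  have \<Delta>m: "(\<lambda>\<omega> t. \<Delta> h t \<omega>) \<in> measurable M (PiM UNIV (\<lambda>_. borel))" for h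
    unfolding \<Delta>_def by (rule measurable_PiM_single') auto
  have \<Delta>_law: "process_law M (\<Delta> h) = process_law M (\<Delta> 0)" for h
    using assms(3) unfolding stationary_increments_def \<Delta>_def by blast
  have \<Delta>_moment: "second_moment (\<Delta> h t) = second_moment (\<Delta> 0 t)" for h t
  proof -
    have "second_moment (\<Delta> h t) = (LINT x|process_law M (\<Delta> h). (x t)\<^sup>2)" for h
      unfolding process_law_def by (subst integral_distr[OF \<Delta>m]) auto
    then show ?thesis by (simp add: \<Delta>_law[of h])
  qed
  have \<Delta>_prob: "emeasure M {\<omega> \<in> space M. \<exists>t\<in>J. y t < \<Delta> h t \<omega>} = emeasure M {\<omega> \<in> space M. \<exists>t\<in>J. y t < \<Delta> 0 t \<omega>}"
    if J: "finite J" for h J and y :: "real ^ 'd \<Rightarrow> real"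
  proof -
    let ?B = "{x \<in> space (PiM UNIV (\<lambda>_. borel)). \<exists>t\<in>J. y t < x t}"
    have B: "?B \<in> sets (PiM UNIV (\<lambda>_. borel))" using J by measurable
    have "emeasure M {\<omega> \<in> space M. \<exists>t\<in>J. y t < \<Delta> h t \<omega>} = emeasure (process_law M (\<Delta> h)) ?B" for h
      unfolding process_law_def emeasure_distr[OF \<Delta>m B]
      by (intro arg_cong[where f="emeasure M"]) (auto simp: space_PiM)
    then show ?thesis by (simp add: \<Delta>_law[of h])
  qed
  have G_shift: "(LINT u|exp_intensity. G h J y u) = (LINT u|exp_intensity. G 0 J y u)" if J: "finite J" for h J y
  proof -
    \<comment> \<open>Taking \<open>s = h\<close> as reference for the points \<open>t + h\<close>
      yields the increments \<open>\<Delta> h\<close>. The common value is written with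
      \<open>\<Delta> 0\<close>, hence free of \<open>h\<close>, and the claim is used both at the
      given shift and at 0.\<close>
    have "(\<integral>\<^sup>+u. ennreal (G h J y u) \<partial>exp_intensity) =
        (\<integral>\<^sup>+u. emeasure M {\<omega> \<in> space M. \<exists>t\<in>J. y t - u + second_moment (\<Delta> 0 t) / 2 < \<Delta> 0 t \<omega>} \<partial>exp_intensity)" for h
    proof -
      have "(\<integral>\<^sup>+u. ennreal (G h J y u) \<partial>exp_intensity) =
          (\<integral>\<^sup>+u. emeasure M {\<omega> \<in> space M. \<exists>t\<in>J. y t < u + (\<Delta> h t \<omega> - second_moment (\<Delta> h t) / 2)} \<partial>exp_intensity)"
        unfolding G_nn \<Delta>_def by (rule exceedance_intensity_increments[OF J])
      \<comment> \<open>For fixed \<open>u\<close>, the point and the drift are moved into the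
        threshold. What remains is an event about \<open>\<Delta> h\<close> alone, whose probability
        and drift are determined by its law.\<close>
      also have "\<dots> = (\<integral>\<^sup>+u. emeasure M {\<omega> \<in> space M. \<exists>t\<in>J. y t - u + second_moment (\<Delta> h t) / 2 < \<Delta> h t \<omega>} \<partial>exp_intensity)"
        by (simp add: algebra_simps)
      finally show ?thesis by (simp only: \<Delta>_prob[OF J, of _ h] \<Delta>_moment[of h])
    qed
    then show ?thesis
      by (subst (1 2) integral_eq_nn_integral) (auto simp: G_meas[OF J], auto simp: G_def)
  qed
  have "stationary_process N (brown_resnick_sup X U)" if R: "brown_resnick_realisation M \<xi> N X U"
    for N :: "'b measure" and X U
  proof -
    have N: "prob_space N" using R by (simp add: brown_resnick_realisation_def)
    have [measurable]: "X i t \<in> borel_measurable N" for i t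
      using R by (auto simp: brown_resnick_realisation_def independent_copies_def stochastic_process_def)
    have [measurable]: "U i \<in> borel_measurable N" for i
      using R by (simp add: brown_resnick_realisation_def poisson_point_process_def stochastic_process_def)
    have sup_meas [measurable]: "brown_resnick_sup X U t \<in> borel_measurable N" for t
      unfolding brown_resnick_sup_def[abs_def] by measurable
    have "finite_dim_distr N (\<lambda>t. brown_resnick_sup X U (t + h)) J = finite_dim_distr N (brown_resnick_sup X U) J"
      if J: "finite J" for h J
      unfolding finite_dim_distr_def
    proof (rule joint_law_eq_of_cdf_eq[OF N N J])
      fix c :: "real ^ 'd \<Rightarrow> ereal"
      show "measure N {\<omega> \<in> space N. \<forall>t\<in>J. brown_resnick_sup X U (t + h) \<omega> \<le> c t} =
          measure N {\<omega> \<in> space N. \<forall>t\<in>J. brown_resnick_sup X U t \<omega> \<le> c t}"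
      \<comment> \<open>Thresholds are extended reals, but the formula for the distribution function
        is for real ones. A threshold \<open>-\<infinity>\<close> makes both events empty, since
        every supremum dominates a real number.\<close>
      proof (cases "\<exists>t\<in>J. c t = -\<infinity>")
        case True
        have "-\<infinity> < brown_resnick_sup X U t \<omega>" for t \<omega>
          unfolding brown_resnick_sup_def by (rule less_SUP_iff[THEN iffD2]) auto
        then have "\<not> brown_resnick_sup X U t \<omega> \<le> -\<infinity>" for t \<omega> by (simp only: not_le)
        then have empty: "{\<omega> \<in> space N. \<forall>t\<in>J. brown_resnick_sup X U (\<tau> t) \<omega> \<le> c t} = {}" for \<tau>
          using True by fastforce
        show ?thesis by (simp only: empty[of "\<lambda>t. t + h"] empty[of "\<lambda>t. t"])
      next
        case False
        \<comment> \<open>Thresholds \<infinity> impose no constraint and their indices are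
          discarded; the remaining ones are real.\<close>
        define J' where "J' = {t\<in>J. c t \<noteq> \<infinity>}"
        define y where "y t = real_of_ereal (c t)" for t
        have J': "finite J'" using J by (simp add: J'_def)
        have c: "c t = ereal (y t)" if "t \<in> J'" for t
          using False that by (cases "c t") (auto simp: J'_def y_def)
        have "(\<forall>t\<in>J. f t \<le> c t) \<longleftrightarrow> (\<forall>t\<in>J'. f t \<le> c t)" for f
          by (auto simp: J'_def)
        then have c_iff: "(\<forall>t\<in>J. f t \<le> c t) \<longleftrightarrow> (\<forall>t\<in>J'. f t \<le> ereal (y t))" for f
          by (simp add: c)
        have drop: "{\<omega> \<in> space N. \<forall>t\<in>J. brown_resnick_sup X U (\<tau> t) \<omega> \<le> c t} =
            {\<omega> \<in> space N. \<forall>t\<in>J'. brown_resnick_sup X U (\<tau> t) \<omega> \<le> ereal (y t)}" for \<tau>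
          by (simp only: c_iff)
        have "measure N {\<omega> \<in> space N. \<forall>t\<in>J. brown_resnick_sup X U (t + h) \<omega> \<le> c t} =
            exp (- (LINT u|exp_intensity. G h J' y u))" for h
          unfolding drop
          by (rule brown_resnick_realisation_cdf[OF R M\<xi> J' _ G_int[OF J']]) (simp add: G_def[abs_def])
        from this[of h] this[of 0] show ?thesis by (simp only: add_0_right G_shift[OF J', of h])
      qed
    qed auto
    then show ?thesis
      by (auto simp: stationary_process_def stochastic_process_def N)
  qed
  then show ?thesis
    unfolding \<xi>_eq brown_resnick_stationary_def using M\<xi> exp_int by blast
qed

end
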